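(* Let $\Phi:M_n\to M_n$ be an irreducible, positive, trace preserving linear map and let $V$ be a nontrivial subspace of $\mathbb{C}^n$ (i.e. $V\neq\{0\}$ and $V\neq\mathbb{C}^n$). Let $Z$ be the fundamental map of $\Phi$ and $K$ the mean hitting time map for $V$. Let $\psi\in V$ be any unit vector and let $\phi\in\mathbb{C}^n$ be an arbitrary unit vector. If $\mathbb{Q}\Phi\rho_\phi\neq0$, put $\hat\rho_\phi=\dfrac{\mathbb{Q}\Phi\rho_\phi}{\operatorname{Tr}(\mathbb{Q}\Phi\rho_\phi)}$. Then $$\tau(\phi\to V)=\begin{cases}1,&\text{if }\mathbb{Q}\Phi\rho_\phi=0,\\[2pt] 1+\operatorname{Tr}(\mathbb{Q}\Phi\rho_\phi)\,\operatorname{Tr}\big(K_{11}(Z_{11}\rho_\psi-Z_{12}\hat\rho_\phi)\big),&\text{if }\mathbb{Q}\Phi\rho_\phi\neq0.\end{cases}$$ Equivalently, $$\tau(\phi\to V)=1+\operatorname{Tr}(K_{11}Z_{11}\rho_\psi)\operatorname{Tr}(\mathbb{Q}\Phi\rho_\phi)-\operatorname{Tr}(K_{11}Z_{12}\mathbb{Q}\Phi\rho_\phi).$$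
   Context: $M_n=M_n(\mathbb{C})$ is the space of $n\times n$ complex matrices ($n<\infty$); $I_n$ is the identity matrix and $I$ is the identity map on $M_n$. $\mathbb{C}^n$ carries its standard inner product. Products of linear maps on $M_n$ denote composition, and $\Phi\rho$ means $\Phi(\rho)$. A linear map $\Phi:M_n\to M_n$ is positive if $X\ge 0$ (positive semidefinite) implies $\Phi(X)\ge0$; it is trace preserving if $\operatorname{Tr}(\Phi(X))=\operatorname{Tr}(X)$ for all $X$. A positive map $\Phi$ is irreducible if the only orthogonal projections $P\in M_n$ with $\Phi(PM_nP)\subset PM_nP$ are $P=0$ and $P=I_n$. A density matrix (state) is a positive semidefinite matrix of trace 1. An irreducible positive trace preserving map has a unique invariant state $\pi$ (density matrix with $\Phi(\pi)=\pi$); moreover $\pi$ is strictly positive and every fixed point of $\Phi$ in $M_n$ is a scalar multiple of $\pi$. The fundamental map of $\Phi$ is $Z=(I-\Phi+\Omega)^{-1}$, where $\Omega:M_n\to M_n$, $\Omega(X)=\operatorname{Tr}(X)\,\pi$ (this inverse exists). For a unit vector $\phi\in\mathbb{C}^n$ put $\rho_\phi=\phi\phi^*$. Let $P$ be the orthogonal projection of $\mathbb{C}^n$ onto $V$, $Q=I_n-P$, and define maps on $M_n$ by $\mathbb{P}(X)=PXP$, $\mathbb{Q}(X)=QXQ$. The mean hitting time is defined as follows: for a density matrix $\rho$ and $r\ge1$ let $\pi_r(\rho\to V)=\operatorname{Tr}(\mathbb{P}\Phi(\mathbb{Q}\Phi)^{r-1}\rho)$ and $\pi(\rho\to V)=\sum_{r\ge1}\pi_r(\rho\to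 V)$; then $\tau(\rho\to V)=\sum_{r\ge1}r\,\pi_r(\rho\to V)$ if $\pi(\rho\to V)=1$, and $\tau(\rho\to V)=\infty$ otherwise. For a unit vector $\phi$, $\tau(\phi\to V)=\tau(\rho_\phi\to V)$. The mean hitting time map for $V$ is $K=\Phi(I-\mathbb{Q}\Phi)^{-2}$ (under the assumptions here $I-\mathbb{Q}\Phi$ is invertible). Block notation with respect to $V$: for a linear map $T:M_n\to M_n$, $T_{11}=(I-\mathbb{Q})T(I-\mathbb{Q})$, $T_{12}=(I-\mathbb{Q})T\mathbb{Q}$, $T_{21}=\mathbb{Q}T(I-\mathbb{Q})$, $T_{22}=\mathbb{Q}T\mathbb{Q}$ (all regarded as maps on $M_n$). *)

theory Defs
  imports "HOL-Analysis.Analysis" "HOL-Library.Nonpos_Ints"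
begin

text \<open>
  The space of complex matrices of size $n$ is \<^typ>\<open>complex^'n^'n\<close>, with \<open>CARD('n) = n\<close>. The library
  predicate \<^const>\<open>linear\<close> is linearity over the reals, and \<open>(*s)\<close> multiplies the rows of a
  matrix by a row, so complex scaling of matrices is introduced here; complex linearity of a
  map is then \<open>Vector_Spaces.linear cscale cscale\<close>.
\<close>

type_synonym 'n cmat = "complex^'n^'n"
type_synonym 'n cmap = "'n cmat \<Rightarrow> 'n cmat"

definition cscale :: "complex \<Rightarrow> 'n::finite cmat \<Rightarrow> 'n cmat" where
  "cscale c X = map_matrix ((*) c) X"

lemma vector_space_cscale: "vector_space (cscale :: complex \<Rightarrow> 'n::finite cmat \<Rightarrow> 'n cmat)"
  by unfold_locales (auto simp: cscale_def vec_eq_iff algebra_simps)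

definition cinner :: "complex^'n::finite \<Rightarrow> complex^'n \<Rightarrow> complex" where
  "cinner x y = (\<Sum>i\<in>UNIV. cnj (x $ i) * y $ i)"

definition ctranspose :: "'n::finite cmat \<Rightarrow> 'n cmat" where
  "ctranspose A = transpose (map_matrix cnj A)"

text \<open>Over the complex numbers a nonnegative quadratic form forces the matrix to be Hermitian.\<close>

definition psd :: "'n::finite cmat \<Rightarrow> bool" where
  "psd A \<longleftrightarrow> (\<forall>x. cinner x (A *v x) \<in> \<real>\<^sub>\<ge>\<^sub>0)"

definition density_matrix :: "'n::finite cmat \<Rightarrow> bool" where
  "density_matrix \<rho> \<longleftrightarrow> psd \<rho> \<and> trace \<rho> = 1"

definition orth_projection :: "'n::finite cmat \<Rightarrow> bool" where
  "orth_projection P \<longleftrightarrow> P ** P = P \<and> ctranspose P = P"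

definition proj_onto :: "(complex^'n::finite) set \<Rightarrow> 'n cmat" where
  "proj_onto V = (THE P. orth_projection P \<and> range ((*v) P) = V)"

definition pure_state :: "complex^'n::finite \<Rightarrow> 'n cmat" where
  "pure_state \<phi> = (\<chi> i j. \<phi> $ i * cnj (\<phi> $ j))"

definition positive_map :: "'n::finite cmap \<Rightarrow> bool" where
  "positive_map \<Phi> \<longleftrightarrow> (\<forall>X. psd X \<longrightarrow> psd (\<Phi> X))"

definition trace_preserving :: "'n::finite cmap \<Rightarrow> bool" where
  "trace_preserving \<Phi> \<longleftrightarrow> (\<forall>X. trace (\<Phi> X) = trace X)"

definition irreducible_map :: "'n::finite cmap \<Rightarrow> bool" where
  "irreducible_map \<Phi> \<longleftrightarrow>
     (\<forall>P. orth_projection P \<and> \<Phi> ` range (\<lambda>X. P ** X ** P) \<subseteq> range (\<lambda>X. P ** X ** P)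
        \<longrightarrow> P = 0 \<or> P = mat 1)"

text \<open>
  The descriptions and inverses below (\<open>THE\<close>, \<^const>\<open>inv\<close>) are meaningful for an irreducible,
  positive, trace preserving \<open>\<Phi>\<close> and a nontrivial complex subspace \<open>V\<close>: then the invariant state
  exists and is unique, and the maps being inverted are bijective.
\<close>

definition invariant_state :: "'n::finite cmap \<Rightarrow> 'n cmat" where
  "invariant_state \<Phi> = (THE \<rho>. density_matrix \<rho> \<and> \<Phi> \<rho> = \<rho>)"

definition Omega_map :: "'n::finite cmap \<Rightarrow> 'n cmap" where
  "Omega_map \<Phi> X = cscale (trace X) (invariant_state \<Phi>)"

definition fundamental_map :: "'n::finite cmap \<Rightarrow> 'n cmap" where
  "fundamental_map \<Phi> = inv (\<lambda>X. X - \<Phi> X + Omega_map \<Phi> X)"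

definition PP :: "(complex^'n::finite) set \<Rightarrow> 'n cmap" where
  "PP V X = proj_onto V ** X ** proj_onto V"

definition QQ :: "(complex^'n::finite) set \<Rightarrow> 'n cmap" where
  "QQ V X = (mat 1 - proj_onto V) ** X ** (mat 1 - proj_onto V)"

text \<open>
  The probability of first arriving in \<open>V\<close> at step \<open>r\<close>, for \<open>r \<ge> 1\<close>. The trace is a nonnegative
  real when \<open>\<Phi>\<close> is positive and \<open>\<rho>\<close> is a state, so \<^const>\<open>Re\<close> only changes the type. The series
  over \<open>r \<ge> 1\<close> are indexed by \<open>Suc r\<close> and taken in the extended reals.
\<close>

definition hit_prob_at :: "'n::finite cmap \<Rightarrow> (complex^'n) set \<Rightarrow> 'n cmat \<Rightarrow> nat \<Rightarrow> real" where
  "hit_prob_at \<Phi> V \<rho> r = Re (trace ((PP V \<circ> \<Phi> \<circ> ((QQ V \<circ> \<Phi>) ^^ (r - 1))) \<rho>))"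

definition hit_prob :: "'n::finite cmap \<Rightarrow> (complex^'n) set \<Rightarrow> 'n cmat \<Rightarrow> ereal" where
  "hit_prob \<Phi> V \<rho> = (\<Sum>r. ereal (hit_prob_at \<Phi> V \<rho> (Suc r)))"

definition mean_hitting_time :: "'n::finite cmap \<Rightarrow> (complex^'n) set \<Rightarrow> 'n cmat \<Rightarrow> ereal" where
  "mean_hitting_time \<Phi> V \<rho> =
     (if hit_prob \<Phi> V \<rho> = 1
      then (\<Sum>r. ereal (real (Suc r) * hit_prob_at \<Phi> V \<rho> (Suc r)))
      else \<infinity>)"

definition mean_hitting_map :: "'n::finite cmap \<Rightarrow> (complex^'n) set \<Rightarrow> 'n cmap" where
  "mean_hitting_map \<Phi> V = \<Phi> \<circ> (inv (\<lambda>X. X - QQ V (\<Phi> X)) ^^ 2)"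

definition QQ_compl :: "(complex^'n::finite) set \<Rightarrow> 'n cmap" where
  "QQ_compl V X = X - QQ V X"

definition block11 :: "(complex^'n::finite) set \<Rightarrow> 'n cmap \<Rightarrow> 'n cmap" where
  "block11 V T = QQ_compl V \<circ> T \<circ> QQ_compl V"

definition block12 :: "(complex^'n::finite) set \<Rightarrow> 'n cmap \<Rightarrow> 'n cmap" where
  "block12 V T = QQ_compl V \<circ> T \<circ> QQ V"

end

theory Submission
  imports Defs
begin

text \<open>
  Put \<open>F = \<^bold>Q\<Phi>\<close> and \<open>G = (I - F)\<inverse> = \<Sum>\<^sub>r F\<^sup>r\<close>. As \<open>\<Phi>\<close> preserves the trace, the hitting probabilities at
  the steps \<open>r + 1\<close> are the differences of the traces of \<open>F\<^sup>r\<rho>\<close> and \<open>F\<^sup>r\<^sup>+\<^sup>1\<rho>\<close>, so summation by parts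
  gives \<open>\<tau>(\<rho> \<rightarrow> V) = Tr(G\<rho>)\<close>, and likewise \<open>Tr(K\<^sub>1\<^sub>1Y) = Tr(G(I - \<^bold>Q)Y)\<close>. For a traceless \<open>\<eta>\<close> the
  matrix \<open>X = Z\<eta>\<close> is traceless with \<open>X - \<Phi>X = \<eta>\<close>, hence \<open>G(I - \<^bold>Q)X = X - G\<^bold>Q\<eta>\<close>; the formula is the
  trace of this identity for \<open>\<eta> = Tr(\<sigma>)\<rho>\<^sub>\<psi> - \<sigma>\<close> with \<open>\<sigma> = \<^bold>Q\<Phi>\<rho>\<^sub>\<phi>\<close>, where \<open>\<^bold>Q\<rho>\<^sub>\<psi> = 0\<close> and \<open>\<^bold>Q\<sigma> = \<sigma>\<close>.

  If the traces of \<open>F\<^sup>r\<close> at the identity were not summable, a limit point of normalised partial sums would be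
  a state fixed by \<open>F\<close>. It would be fixed by \<open>\<Phi>\<close> as well and supported off \<open>V\<close>, against irreducibility.
\<close>

section \<open>Complex inner products and positive semidefinite matrices\<close>

lemma cinner_add_left: "cinner (x + y) z = cinner x z + cinner y z"
  by (simp add: cinner_def algebra_simps sum.distrib)

lemma cinner_add_right: "cinner x (y + z) = cinner x y + cinner x z"
  by (simp add: cinner_def algebra_simps sum.distrib)

lemma cinner_diff_right: "cinner x (y - z) = cinner x y - cinner x z"
  by (simp add: cinner_def algebra_simps sum_subtractf)

lemma cinner_scale_left: "cinner (c *s x) y = cnj c * cinner x y"
  by (simp add: cinner_def sum_distrib_left algebra_simps)

lemma cinner_scale_right: "cinner x (c *s y) = c * cinner x y"
  by (simp add: cinner_def sum_distrib_left algebra_simps)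

lemma cinner_commute: "cinner y x = cnj (cinner x y)"
  by (simp add: cinner_def mult.commute)

lemma cinner_zero_right [simp]: "cinner x 0 = 0"
  by (simp add: cinner_def)

lemma cinner_self: "cinner x x = complex_of_real ((norm x)\<^sup>2)"
proof -
  have "cnj (x $ i) * x $ i = complex_of_real ((norm (x $ i))\<^sup>2)" for i
    by (metis complex_norm_square mult.commute)
  then show ?thesis
    by (simp add: cinner_def norm_vec_def L2_set_def sum_nonneg)
qed

lemma Re_cinner: "Re (cinner x y) = inner x y"
  by (simp add: cinner_def inner_vec_def inner_complex_def)

lemma cinner_axis_left: "cinner (axis i 1) x = x $ i"
  by (simp add: cinner_def axis_def if_distrib if_distribR cong: if_cong)

lemma cinner_axis_axis: "cinner (axis i 1) (A *v axis j 1) = A $ i $ j"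
  unfolding cinner_axis_left
  by (simp add: matrix_vector_mult_def axis_def if_distrib if_distribR cong: if_cong)

lemma cinner_adjoint: "cinner x (A *v y) = cinner (ctranspose A *v x) y"
proof -
  have "cinner x (A *v y) = (\<Sum>i\<in>UNIV. \<Sum>j\<in>UNIV. cnj (x $ i) * A $ i $ j * y $ j)"
    by (simp add: cinner_def matrix_vector_mult_def sum_distrib_left mult.assoc)
  also have "\<dots> = (\<Sum>j\<in>UNIV. \<Sum>i\<in>UNIV. cnj (x $ i) * A $ i $ j * y $ j)"
    by (rule sum.swap)
  also have "\<dots> = cinner (ctranspose A *v x) y"
    by (simp add: cinner_def matrix_vector_mult_def ctranspose_def transpose_def map_matrix_def
        sum_distrib_right sum_distrib_left mult_ac)
  finally show ?thesis .
qed

lemma cmat_eqI: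
  fixes A B :: "'n::finite cmat"
  assumes "\<And>x y. cinner x (A *v y) = cinner x (B *v y)"
  shows "A = B"
  using assms by (metis cinner_axis_axis vec_eq_iff)

section \<open>Arithmetic of adjoints and complex scaling\<close>

lemma ctranspose_nth [simp]: "ctranspose A $ i $ j = cnj (A $ j $ i)"
  by (simp add: ctranspose_def transpose_def map_matrix_def)

lemma cscale_nth [simp]: "cscale c A $ i $ j = c * A $ i $ j"
  by (simp add: cscale_def map_matrix_def)

lemma ctranspose_ctranspose [simp]: "ctranspose (ctranspose A) = A"
  by (simp add: vec_eq_iff)

lemma ctranspose_add: "ctranspose (A + B) = ctranspose A + ctranspose B"
  by (simp add: vec_eq_iff)

lemma ctranspose_diff: "ctranspose (A - B) = ctranspose A - ctranspose B"
  by (simp add: vec_eq_iff)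

lemma ctranspose_cscale: "ctranspose (cscale c A) = cscale (cnj c) (ctranspose A)"
  by (simp add: vec_eq_iff)

lemma ctranspose_mult: "ctranspose (A ** B) = ctranspose B ** ctranspose A"
  by (simp add: vec_eq_iff matrix_matrix_mult_def mult.commute)

lemma ctranspose_mat_1 [simp]: "ctranspose (mat 1) = mat 1"
  by (auto simp: vec_eq_iff mat_def)

lemma trace_ctranspose: "trace (ctranspose A) = cnj (trace A)"
  by (simp add: trace_def)

lemma scaleR_eq_cscale: "r *\<^sub>R A = cscale (complex_of_real r) A"
  by (simp add: vec_eq_iff) (simp add: scaleR_conv_of_real)

lemma cscale_matrix_vector: "cscale c A *v x = c *s (A *v x)"
  by (simp add: vec_eq_iff matrix_vector_mult_def sum_distrib_left mult.assoc)

lemma cscale_mult_left: "A ** cscale c B = cscale c (A ** B)"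
  by (simp add: vec_eq_iff matrix_matrix_mult_def sum_distrib_left mult_ac)

lemma cscale_mult_right: "cscale c A ** B = cscale c (A ** B)"
  by (simp add: vec_eq_iff matrix_matrix_mult_def sum_distrib_left mult_ac)

lemma trace_cscale: "trace (cscale c A) = c * trace A"
  by (simp add: trace_def sum_distrib_left)

lemma cscale_add_right: "cscale c (A + B) = cscale c A + cscale c B"
  by (simp add: vec_eq_iff algebra_simps)

lemma cscale_diff_right: "cscale c (A - B) = cscale c A - cscale c B"
  by (simp add: vec_eq_iff algebra_simps)

lemma cscale_cscale: "cscale c (cscale d A) = cscale (c * d) A"
  by (simp add: vec_eq_iff)

lemma cscale_zero [simp]: "cscale c 0 = 0" "cscale 0 A = 0"
  by (simp_all add: vec_eq_iff)

lemma matrix_add_vector: "((A::'n::finite cmat) + B) *v x = A *v x + B *v x"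
  by (simp add: matrix_vector_mult_add_rdistrib)

lemma matrix_diff_vector: "((A::'n::finite cmat) - B) *v x = A *v x - B *v x"
  by (simp add: matrix_vector_mult_diff_rdistrib)

section \<open>Quadratic forms and the positive semidefinite cone\<close>

definition qform :: "'n::finite cmat \<Rightarrow> complex^'n \<Rightarrow> real" where
  "qform A x = Re (cinner x (A *v x))"

lemma cinner_quadratic:
  "cinner (x + c *s y) (A *v (x + c *s y)) =
     cinner x (A *v x) + c * cinner x (A *v y) + cnj c * cinner y (A *v x)
       + (cnj c * c) * cinner y (A *v y)"
  by (simp add: cinner_add_left cinner_add_right cinner_scale_left cinner_scale_right
      matrix_vector_right_distrib vec.scale algebra_simps)

text \<open>Polarisation: reality of the form at \<open>x + y\<close> makes the imaginary parts of
  the two cross terms opposite, and reality at \<open>x + \<i> *s y\<close> makes their real parts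
  equal. The real-valued \<open>qform\<close> then suffices for all later order arguments.\<close>

lemma psd_iff: "psd A \<longleftrightarrow> ctranspose A = A \<and> (\<forall>x. qform A x \<ge> 0)"
proof safe
  assume p: "psd A"
  then have nonneg: "Re (cinner x (A *v x)) \<ge> 0" and real: "Im (cinner x (A *v x)) = 0" for x
    by (auto simp: psd_def complex_nonneg_Reals_iff)
  then show "qform A x \<ge> 0" for x by (simp add: qform_def)
  have 1: "Im (cinner x (A *v y)) + Im (cinner y (A *v x)) = 0" for x y
    using real[of "x + 1 *s y"] real[of x] real[of y] unfolding cinner_quadratic[of x 1 y] by simp
  have 2: "Re (cinner x (A *v y)) - Re (cinner y (A *v x)) = 0" for x y
    using real[of "x + \<i> *s y"] real[of x] real[of y] unfolding cinner_quadratic[of x \<i> y] by simp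
  show "ctranspose A = A"
  proof (rule cmat_eqI)
    fix x y
    have "cinner x (ctranspose A *v y) = cnj (cinner y (A *v x))"
      by (metis cinner_adjoint cinner_commute)
    also have "\<dots> = cinner x (A *v y)"
      using 1[of x y] 2[of x y] by (simp add: complex_eq_iff)
    finally show "cinner x (ctranspose A *v y) = cinner x (A *v y)" .
  qed
next
  assume h: "ctranspose A = A" and q: "\<forall>x. qform A x \<ge> 0"
  have "Im (cinner x (A *v x)) = 0" for x
    by (metis cinner_adjoint cinner_commute h complex_is_Real_iff Reals_cnj_iff)
  then show "psd A" using q by (simp add: psd_def qform_def complex_nonneg_Reals_iff)
qed

lemma qform_add: "qform (A + B) x = qform A x + qform B x"
  by (simp add: qform_def matrix_add_vector cinner_add_right)

lemma qform_diff: "qform (A - B) x = qform A x - qform B x"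
  by (simp add: qform_def matrix_diff_vector cinner_diff_right)

lemma qform_scaleR: "qform (r *\<^sub>R A) x = r * qform A x"
  by (simp add: qform_def scaleR_eq_cscale cscale_matrix_vector cinner_scale_right)

lemma qform_mat_1: "qform (mat 1) x = (norm x)\<^sup>2"
  by (simp add: qform_def cinner_self)

lemma ctranspose_scaleR: "ctranspose (r *\<^sub>R A) = r *\<^sub>R ctranspose A"
  by (simp add: scaleR_eq_cscale ctranspose_cscale)

lemma psd_zero [simp]: "psd 0"
  by (simp add: psd_def)

lemma psd_add: "psd A \<Longrightarrow> psd B \<Longrightarrow> psd (A + B)"
  by (simp add: psd_iff qform_add ctranspose_add)

lemma psd_scaleR: "psd A \<Longrightarrow> r \<ge> 0 \<Longrightarrow> psd (r *\<^sub>R A)"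
  by (simp add: psd_iff qform_scaleR ctranspose_scaleR)

lemma psd_sum: "(\<And>i. i \<in> I \<Longrightarrow> psd (f i)) \<Longrightarrow> psd (sum f I)"
  by (induction I rule: infinite_finite_induct) (auto intro: psd_add)

lemma psd_mat_1 [simp]: "psd (mat 1)"
  by (simp add: psd_iff qform_mat_1)

lemma psd_sandwich: "psd A \<Longrightarrow> psd (ctranspose B ** A ** B)"
proof -
  assume "psd A"
  moreover have "cinner x ((ctranspose B ** A ** B) *v x) = cinner (B *v x) (A *v (B *v x))" for x
    by (simp add: cinner_adjoint flip: matrix_vector_mul_assoc)
  ultimately show ?thesis by (simp add: psd_def)
qed

section \<open>Cauchy-Schwarz for semidefinite forms\<close>

lemma psd_cinner_hermitian: "psd A \<Longrightarrow> cinner y (A *v x) = cnj (cinner x (A *v y))"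
  by (metis cinner_adjoint cinner_commute psd_iff)

lemma psd_cauchy_schwarz:
  assumes "psd A"
  shows "(cmod (cinner x (A *v y)))\<^sup>2 \<le> qform A x * qform A y"
proof -
  define b where "b = cinner x (A *v y)"
  have b': "cinner y (A *v x) = cnj b"
    unfolding b_def by (rule psd_cinner_hermitian[OF assms])
  have q: "0 \<le> qform A x + 2 * s * (cmod b)\<^sup>2 + s\<^sup>2 * (cmod b)\<^sup>2 * qform A y" for s :: real
  proof -
    \<comment> \<open>The phase of \<open>cnj b\<close> makes the cross term real, so nonnegativity
      of the form along this line becomes a real quadratic inequality in \<open>s\<close>.\<close>
    define c where "c = complex_of_real s * cnj b"
    have 1: "Re (c * b + cnj c * cnj b) = 2 * s * (cmod b)\<^sup>2"
      unfolding c_def cmod_power2 by (simp add: power2_eq_square algebra_simps)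
    have 2: "cnj c * c = complex_of_real (s\<^sup>2 * (cmod b)\<^sup>2)"
      unfolding c_def cmod_power2
      by (simp add: complex_eq_iff power2_eq_square algebra_simps)
    have "qform A (x + c *s y) =
        qform A x + Re (c * b + cnj c * cnj b) + s\<^sup>2 * (cmod b)\<^sup>2 * qform A y"
      unfolding qform_def cinner_quadratic b' b_def[symmetric] 2 by simp
    then have "qform A (x + c *s y) =
        qform A x + 2 * s * (cmod b)\<^sup>2 + s\<^sup>2 * (cmod b)\<^sup>2 * qform A y"
      unfolding 1 .
    then show ?thesis using assms by (metis psd_iff)
  qed
  have nn: "qform A x \<ge> 0" "qform A y \<ge> 0" using assms by (auto simp: psd_iff)
  show ?thesis
  proof (cases "qform A y = 0")
    case True
    have "cmod b = 0"
    proof (rule ccontr)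
      assume "cmod b \<noteq> 0"
      \<comment> \<open>Without its square term the inequality is affine in \<open>s\<close>; this
        \<open>s\<close> brings its right-hand side down to -1.\<close>
      then have "2 * (- (qform A x + 1) / (2 * (cmod b)\<^sup>2)) * (cmod b)\<^sup>2 = - (qform A x + 1)"
        by simp
      with q[of "- (qform A x + 1) / (2 * (cmod b)\<^sup>2)"] True show False by simp
    qed
    then show ?thesis using nn unfolding b_def by simp
  next
    case False
    with nn have pos: "qform A y > 0" by simp
    \<comment> \<open>The value \<open>- 1 / qform A y\<close> of \<open>s\<close> minimises the
      quadratic.\<close>
    have "(- 1 / qform A y)\<^sup>2 * (cmod b)\<^sup>2 * qform A y = (cmod b)\<^sup>2 / qform A y"
      using pos by (simp add: power2_eq_square)
    with q[of "- 1 / qform A y"] have "(cmod b)\<^sup>2 / qform A y \<le> qform A x" by simp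
    then have "(cmod b)\<^sup>2 \<le> qform A x * qform A y"
      using pos by (simp only: pos_divide_le_eq)
    then show ?thesis unfolding b_def .
  qed
qed

text \<open>By Cauchy-Schwarz \<open>A *v x\<close> is orthogonal to every vector, itself
  included.\<close>

lemma psd_kernel:
  assumes "psd A" "qform A x = 0"
  shows "A *v x = 0"
proof -
  have "cinner y (A *v x) = 0" for y
    using psd_cauchy_schwarz[OF assms(1), of y x] assms(2) by simp
  then have "cinner (A *v x) (A *v x) = 0" by blast
  then show ?thesis by (simp add: cinner_self)
qed

section \<open>Control of semidefinite matrices by the trace\<close>

lemma psd_trace: "psd A \<Longrightarrow> trace A = complex_of_real (Re (trace A)) \<and> Re (trace A) \<ge> 0"
proof -
  assume "psd A"
  then have "A $ i $ i \<in> \<real>\<^sub>\<ge>\<^sub>0" for i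
    by (metis cinner_axis_axis psd_def)
  then show ?thesis
    by (simp add: trace_def complex_nonneg_Reals_iff complex_eq_iff sum_nonneg)
qed

text \<open>Cauchy-Schwarz at two basis vectors bounds an entry by the geometric mean of two
  diagonal entries, each of which is at most the trace.\<close>

lemma psd_entry_le_trace: "psd A \<Longrightarrow> cmod (A $ i $ j) \<le> Re (trace A)"
proof -
  assume p: "psd A"
  have d: "qform A (axis k 1) = Re (A $ k $ k)" for k
    by (simp add: qform_def cinner_axis_axis)
  then have nn: "0 \<le> Re (A $ k $ k)" for k
    using p by (metis psd_iff)
  have le: "Re (A $ k $ k) \<le> Re (trace A)" for k
    unfolding trace_def Re_sum using nn by (intro member_le_sum) auto
  have "(cmod (A $ i $ j))\<^sup>2 \<le> Re (A $ i $ i) * Re (A $ j $ j)"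
    using psd_cauchy_schwarz[OF p, of "axis i 1" "axis j 1"] by (simp add: cinner_axis_axis d)
  also have "\<dots> \<le> (Re (trace A))\<^sup>2"
    unfolding power2_eq_square by (intro mult_mono le nn order_trans[OF nn le])
  finally show ?thesis
    by (rule power2_le_imp_le) (rule order_trans[OF nn le])
qed

lemma cmat_norm_le: "norm (A :: 'n::finite cmat) \<le> (\<Sum>i\<in>UNIV. \<Sum>j\<in>UNIV. cmod (A $ i $ j))"
proof -
  have "norm A \<le> (\<Sum>i\<in>UNIV. norm (A $ i))"
    unfolding norm_vec_def[of A] by (rule L2_set_le_sum) simp
  also have "\<dots> \<le> (\<Sum>i\<in>UNIV. \<Sum>j\<in>UNIV. cmod (A $ i $ j))"
    unfolding norm_vec_def by (intro sum_mono L2_set_le_sum) simp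
  finally show ?thesis .
qed

text \<open>The factor counts the entries. On the cone, convergence and boundedness can thus be read
  off from traces.\<close>

lemma psd_norm_le_trace:
  "psd (A :: 'n::finite cmat) \<Longrightarrow> norm A \<le> (real CARD('n))\<^sup>2 * Re (trace A)"
proof -
  assume p: "psd A"
  have "norm A \<le> (\<Sum>i::'n\<in>UNIV. \<Sum>j::'n\<in>UNIV. Re (trace A))"
    using psd_entry_le_trace[OF p] by (intro order_trans[OF cmat_norm_le] sum_mono)
  then show ?thesis by (simp add: power2_eq_square)
qed

lemma psd_trace_0: "psd A \<Longrightarrow> Re (trace A) = 0 \<Longrightarrow> A = 0"
  using psd_norm_le_trace[of A] by simp

text \<open>An operator norm bound \<open>c\<close> dominates the quadratic form on both sides. This
  writes a Hermitian matrix as a difference of two semidefinite ones, which is how positivity of a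
  map gets applied to it.\<close>

lemma hermitian_bounded:
  fixes A :: "'n::finite cmat"
  assumes "ctranspose A = A"
  obtains c where "c \<ge> 0" "psd (c *\<^sub>R mat 1 + A)" "psd (c *\<^sub>R mat 1 - A)"
proof -
  obtain c where c: "c > 0" "\<And>x. norm (A *v x) \<le> norm x * c"
    using bounded_linear.pos_bounded[OF matrix_vector_mul_bounded_linear, of A] by blast
  have "\<bar>qform A x\<bar> \<le> c * (norm x)\<^sup>2" for x
  proof -
    have "\<bar>qform A x\<bar> \<le> norm x * norm (A *v x)"
      unfolding qform_def Re_cinner by (rule Cauchy_Schwarz_ineq2)
    also have "\<dots> \<le> norm x * (norm x * c)"
      by (intro mult_left_mono c) simp
    finally show ?thesis by (simp add: power2_eq_square mult_ac)
  qed
  then have "0 \<le> c * (norm x)\<^sup>2 + qform A x \<and> 0 \<le> c * (norm x)\<^sup>2 - qform A x" for x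
    by (smt (verit))
  then have "psd (c *\<^sub>R mat 1 + A)" "psd (c *\<^sub>R mat 1 - A)"
    using assms by (auto simp: psd_iff qform_add qform_diff qform_scaleR qform_mat_1
        ctranspose_add ctranspose_diff ctranspose_scaleR)
  with c(1) show thesis by (intro that[of c]) auto
qed

section \<open>Orthogonal projections and pure states\<close>

lemma orth_projection_range:
  assumes "orth_projection P" "v \<in> range ((*v) P)"
  shows "P *v v = v"
  using assms by (auto simp: orth_projection_def matrix_vector_mul_assoc)

text \<open>Each projection fixes the common range, so \<open>P ** R = R\<close> and
  \<open>R ** P = P\<close>; taking adjoints in the first identity gives
  \<open>R ** P = R\<close>.\<close>

lemma orth_projection_unique:
  assumes "orth_projection P" "orth_projection R" "range ((*v) P) = range ((*v) R)"
  shows "P = R"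
proof -
  have 1: "P ** R = R"
    unfolding matrix_eq matrix_vector_mul_assoc[symmetric]
    using orth_projection_range[OF assms(1)] assms(3) by blast
  have 2: "R ** P = P"
    unfolding matrix_eq matrix_vector_mul_assoc[symmetric]
    using orth_projection_range[OF assms(2)] assms(3) by blast
  have "ctranspose (P ** R) = R ** P"
    using assms by (simp add: ctranspose_mult orth_projection_def)
  with 1 2 show ?thesis using assms by (simp add: orth_projection_def)
qed

text \<open>The real orthogonal decomposition is used. Since \<open>V\<close> is closed under
  multiplication by \<open>\<i>\<close>, real orthogonality to \<open>V\<close> is Hermitian
  orthogonality, and uniqueness of the component in \<open>V\<close> makes the projection complex
  linear.\<close>

lemma orth_projection_exists:
  fixes V :: "(complex^'n::finite) set"
  assumes V: "vec.subspace V"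
  obtains P where "orth_projection P" "range ((*v) P) = V"
proof -
  have scale: "r *\<^sub>R x = complex_of_real r *s x" for r and x :: "complex^'n"
    by (simp add: vec_eq_iff) (simp add: scaleR_conv_of_real)
  have Vr: "subspace V"
    using V unfolding subspace_def vec.subspace_def scale by blast
  have ex: "\<exists>y. y \<in> V \<and> (\<forall>w\<in>V. cinner w (x - y) = 0)" for x
  proof -
    obtain y z where yz: "y \<in> span V" "\<And>w. w \<in> span V \<Longrightarrow> orthogonal z w" "x = y + z"
      using orthogonal_subspace_decomp_exists by blast
    have sp: "span V = V" using Vr by (rule span_eq_iff[THEN iffD2])
    have "cinner w z = 0" if "w \<in> V" for w
    proof -
      \<comment> \<open>Testing with \<open>w\<close> kills the real part of the inner product,
        testing with \<open>\<i> *s w\<close> the imaginary part.\<close>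
      have "\<i> *s w \<in> V" using V that by (simp add: vec.subspace_scale)
      then have "Re (cinner w z) = 0" "Re (cinner (\<i> *s w) z) = 0"
        using yz(2) that unfolding sp Re_cinner orthogonal_def by (metis inner_commute)+
      then show ?thesis by (simp add: cinner_scale_left complex_eq_iff)
    qed
    moreover have "x - y = z" using yz(3) by simp
    ultimately show ?thesis using yz(1) unfolding sp by metis
  qed
  then obtain p where p: "\<And>x. p x \<in> V" "\<And>x w. w \<in> V \<Longrightarrow> cinner w (x - p x) = 0"
    by metis
  have uniq: "p x = y" if "y \<in> V" "\<And>w. w \<in> V \<Longrightarrow> cinner w (x - y) = 0" for x y
  proof -
    have d: "p x - y \<in> V" using vec.subspace_diff[OF V p(1) that(1)] .
    have "cinner (p x - y) ((x - y) - (x - p x)) = 0"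
      unfolding cinner_diff_right[of _ "x - y"] p(2)[OF d] that(2)[OF d] by simp
    then have "p x - y = 0" by (simp add: cinner_self)
    then show ?thesis by simp
  qed
  have lin: "Vector_Spaces.linear (*s) (*s) p"
  proof (unfold_locales)
    show "p (x + y) = p x + p y" for x y
    proof (rule uniq)
      have "x + y - (p x + p y) = (x - p x) + (y - p y)" by simp
      then show "cinner w (x + y - (p x + p y)) = 0" if "w \<in> V" for w
        using p(2)[OF that] by (simp only: cinner_add_right) simp
    qed (rule vec.subspace_add[OF V p(1) p(1)])
    show "p (c *s x) = c *s p x" for c x
    proof (rule uniq)
      have "c *s x - c *s p x = c *s (x - p x)" by (simp add: vec.scale_right_diff_distrib)
      then show "cinner w (c *s x - c *s p x) = 0" if "w \<in> V" for w
        using p(2)[OF that] by (simp only: cinner_scale_right) simp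
    qed (rule vec.subspace_scale[OF V p(1)])
  qed
  have P: "matrix p *v x = p x" for x using lin by (rule matrix_works)
  have id: "p v = v" if "v \<in> V" for v using that by (intro uniq) auto
  have range: "range ((*v) (matrix p)) = V"
    unfolding P[abs_def] using p(1) id by (metis image_subset_iff rangeI subsetI subset_antisym UNIV_I)
  have "matrix p ** matrix p = matrix p"
    unfolding matrix_eq matrix_vector_mul_assoc[symmetric] P using id[OF p(1)] by blast
  moreover have "ctranspose (matrix p) = matrix p"
  proof (rule cmat_eqI)
    fix x y
    have a: "cinner w y = cinner w (p y)" if "w \<in> V" for w y
      using p(2)[OF that, of y] by (simp add: cinner_diff_right)
    have "cinner x (ctranspose (matrix p) *v y) = cinner (p x) y"
      using cinner_adjoint[of x "ctranspose (matrix p)" y] by (simp only: ctranspose_ctranspose P)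
    also have "\<dots> = cinner (p x) (p y)" using p(1) by (rule a)
    also have "\<dots> = cnj (cinner (p y) (p x))" by (rule cinner_commute)
    also have "\<dots> = cnj (cinner (p y) x)" using a[OF p(1)] by (simp only:)
    also have "\<dots> = cinner x (p y)" by (rule cinner_commute[symmetric])
    finally show "cinner x (ctranspose (matrix p) *v y) = cinner x (matrix p *v y)"
      by (simp only: P)
  qed
  ultimately have "orth_projection (matrix p)" by (simp add: orth_projection_def)
  with range show thesis by (intro that)
qed

lemma proj_onto:
  assumes "vec.subspace V"
  shows "orth_projection (proj_onto V)" "range ((*v) (proj_onto V)) = V"
proof -
  have "\<exists>!P. orth_projection P \<and> range ((*v) P) = V"
    using orth_projection_exists[OF assms] orth_projection_unique by metis
  then have "orth_projection (proj_onto V) \<and> range ((*v) (proj_onto V)) = V"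
    unfolding proj_onto_def by (rule theI')
  then show "orth_projection (proj_onto V)" "range ((*v) (proj_onto V)) = V" by auto
qed

section \<open>Rank-one states\<close>

lemma pure_state_cinner:
  "cinner x (pure_state v *v y) = cinner x v * cinner v y"
  by (simp add: cinner_def pure_state_def matrix_vector_mult_def sum_product sum_distrib_left mult_ac)
    (rule sum.swap)

lemma psd_pure_state: "psd (pure_state v)"
proof -
  have "cinner x (pure_state v *v x) = complex_of_real ((cmod (cinner x v))\<^sup>2)" for x
    using complex_norm_square[of "cinner x v"] by (simp add: pure_state_cinner flip: cinner_commute)
  then show ?thesis by (simp add: psd_def)
qed

lemma trace_pure_state: "trace (pure_state v) = complex_of_real ((norm v)\<^sup>2)"
  unfolding cinner_self[symmetric] by (simp add: trace_def pure_state_def cinner_def mult.commute)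

lemma pure_state_mult:
  "A *v v = 0 \<Longrightarrow> A ** pure_state v = 0"
  by (simp add: vec_eq_iff matrix_matrix_mult_def matrix_vector_mult_def pure_state_def
      flip: mult.assoc sum_distrib_right)

section \<open>Positive maps\<close>

abbreviation clinear :: "'n::finite cmap \<Rightarrow> bool" where
  "clinear \<equiv> Vector_Spaces.linear cscale cscale"

lemma clinear_iff:
  "clinear L \<longleftrightarrow> (\<forall>X Y. L (X + Y) = L X + L Y) \<and> (\<forall>c X. L (cscale c X) = cscale c (L X))"
  by (simp add: Vector_Spaces.linear_iff vector_space_cscale)

lemma clinear_imp_linear: "clinear L \<Longrightarrow> linear L"
  by (rule linearI) (simp_all add: clinear_iff scaleR_eq_cscale)

lemma clinear_compose: "clinear L \<Longrightarrow> clinear M \<Longrightarrow> clinear (\<lambda>X. L (M X))"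
  by (simp add: clinear_iff)

lemma clinear_funpow: "clinear L \<Longrightarrow> clinear (L ^^ r)"
  by (induction r) (simp_all add: clinear_iff)

lemma clinear_diff: "clinear L \<Longrightarrow> L (X - Y) = L X - L Y"
  by (rule linear_diff) (rule clinear_imp_linear)

lemma hermitian_decomposition:
  obtains H K where "ctranspose H = H" "ctranspose K = K" "X = H + cscale \<i> K"
proof
  show "ctranspose (cscale (1/2) (X + ctranspose X)) = cscale (1/2) (X + ctranspose X)"
    "ctranspose (cscale (-\<i>/2) (X - ctranspose X)) = cscale (-\<i>/2) (X - ctranspose X)"
    "X = cscale (1/2) (X + ctranspose X) + cscale \<i> (cscale (-\<i>/2) (X - ctranspose X))"
    by (simp_all add: vec_eq_iff field_simps)
qed

text \<open>Shift \<open>X\<close> into the cone by a multiple of the identity: the images of the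
  shifted matrix and of the shift are semidefinite, hence Hermitian, and so is their
  difference.\<close>

lemma positive_map_hermitian:
  assumes "linear L" "positive_map L" "ctranspose X = X"
  shows "ctranspose (L X) = L X"
proof -
  obtain c where "psd (c *\<^sub>R mat 1 + X)" "c \<ge> 0"
    using hermitian_bounded[OF assms(3)] by blast
  then have "ctranspose (L (c *\<^sub>R mat 1 + X)) = L (c *\<^sub>R mat 1 + X)"
    "ctranspose (L (c *\<^sub>R mat 1)) = L (c *\<^sub>R mat 1)"
    using assms(2) unfolding positive_map_def psd_iff[symmetric]
    by (meson psd_iff psd_scaleR psd_mat_1)+
  then show ?thesis
    by (simp add: linear_add[OF assms(1)] ctranspose_add)
qed

section \<open>Compactness of the state space and powers of a positive map\<close>

lemma linear_qform: "linear (\<lambda>A. qform A x)"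
  by (rule linearI) (simp_all add: qform_add qform_scaleR)

lemma linear_trace: "linear (trace :: 'n::finite cmat \<Rightarrow> complex)"
  by (rule linearI) (simp_all add: trace_add scaleR_eq_cscale trace_cscale scaleR_conv_of_real)

lemma linear_ctranspose: "linear ctranspose"
  by (rule linearI) (simp_all add: ctranspose_add ctranspose_scaleR)

lemma compact_density: "compact {A :: 'n::finite cmat. density_matrix A}"
proof -
  have cont: "continuous_on UNIV f" if "linear f" for f :: "'n cmat \<Rightarrow> 'b::euclidean_space"
    using that by (rule linear_continuous_on[OF linear_conv_bounded_linear[THEN iffD1]])
  have "{A :: 'n cmat. density_matrix A} =
      {A. ctranspose A = A} \<inter> {A. \<forall>x. 0 \<le> qform A x} \<inter> {A. trace A = 1}"
    by (auto simp: density_matrix_def psd_iff)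
  moreover have "closed {A :: 'n cmat. ctranspose A = A}"
    by (intro closed_Collect_eq cont linear_ctranspose continuous_on_id)
  moreover have "closed {A :: 'n cmat. \<forall>x. 0 \<le> qform A x}"
    by (intro closed_Collect_all closed_Collect_le cont linear_qform continuous_on_const)
  moreover have "closed {A :: 'n cmat. trace A = 1}"
    by (intro closed_Collect_eq cont linear_trace continuous_on_const)
  ultimately have "closed {A :: 'n cmat. density_matrix A}" by (simp only: closed_Int)
  moreover have "bounded {A :: 'n cmat. density_matrix A}"
    using psd_norm_le_trace by (intro boundedI[where B = "(real CARD('n))\<^sup>2"])
      (force simp: density_matrix_def)
  ultimately show ?thesis by (simp add: compact_eq_bounded_closed)
qed

lemma positive_map_funpow:
  assumes "positive_map L" "psd X" shows "psd ((L ^^ r) X)"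
  using assms by (induction r) (simp_all add: positive_map_def)

text \<open>
  The normalised partial sums of the powers of \<open>L\<close> at the identity are almost fixed by \<open>L\<close>, as
  their traces are unbounded; any limit point of them is fixed.
\<close>

lemma fixed_density_of_not_summable:
  fixes L :: "'n::finite cmap"
  assumes lin: "linear L" and pos: "positive_map L"
    and dec: "\<And>X. psd X \<Longrightarrow> Re (trace (L X)) \<le> Re (trace X)"
    and ns: "\<not> summable (\<lambda>r. Re (trace ((L ^^ r) (mat 1))))"
  obtains Y where "density_matrix Y" "L Y = Y"
proof -
  define a where "a r = Re (trace ((L ^^ r) (mat 1)))" for r
  define S where "S N = (\<Sum>r\<le>N. (L ^^ r) (mat 1))" for N
  have P: "psd ((L ^^ r) (mat 1))" for r using pos by (simp add: positive_map_funpow)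
  have a0: "0 \<le> a r" for r unfolding a_def using psd_trace[OF P] by blast
  have aN: "a r \<le> a 0" for r
  proof (induction r)
    case (Suc r)
    have "a (Suc r) \<le> a r" unfolding a_def using dec[OF P[of r]] by simp
    with Suc show ?case by linarith
  qed simp
  have psdS: "psd (S N)" for N unfolding S_def by (rule psd_sum) (rule P)
  have trS: "Re (trace (S N)) = (\<Sum>r\<le>N. a r)" for N
    by (simp add: S_def a_def linear_sum[OF linear_trace])
  \<comment> \<open>Telescoping leaves only the end terms, and \<open>C\<close> bounds these
    uniformly in \<open>N\<close> because the traces of the powers never exceed
    \<open>a 0\<close>.\<close>
  have LS: "L (S N) - S N = (L ^^ Suc N) (mat 1) - mat 1" for N
  proof (induction N)
    case (Suc N)
    then show ?case by (simp add: S_def linear_add[OF lin] algebra_simps)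
  qed (simp add: S_def)
  define C where "C = (real CARD('n))\<^sup>2 * a 0 + norm (mat 1 :: 'n cmat)"
  have bnd: "norm (L (S N) - S N) \<le> C" for N
  proof -
    have "norm ((L ^^ Suc N) (mat 1)) \<le> (real CARD('n))\<^sup>2 * a (Suc N)"
      unfolding a_def by (rule psd_norm_le_trace[OF P])
    also have "\<dots> \<le> (real CARD('n))\<^sup>2 * a 0" by (intro mult_left_mono aN) simp
    finally show ?thesis unfolding LS C_def
      by (rule order_trans[OF norm_triangle_ineq4 add_mono[OF _ order_refl]])
  qed
  \<comment> \<open>Nonnegative terms with bounded partial sums would be summable. The choice of
    \<open>N k\<close> makes the normalising trace exceed \<open>Suc k\<close>, so the defect of
    \<open>Y k\<close> is at most \<open>C / Suc k\<close>.\<close>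
  have "\<exists>N. (\<Sum>r\<le>N. a r) > real (Suc k)" for k
    using bounded_imp_summable[of a "real (Suc k)"] a0 ns unfolding a_def[symmetric]
    by (meson not_le)
  then obtain N where N: "(\<Sum>r\<le>N k. a r) > real (Suc k)" for k by metis
  define t where "t k = (\<Sum>r\<le>N k. a r)" for k
  have t: "t k > real (Suc k)" for k unfolding t_def by (rule N)
  have tpos: "t k > 0" for k using t[of k] by simp
  define Y where "Y k = (1 / t k) *\<^sub>R S (N k)" for k
  have dens: "density_matrix (Y k)" for k
  proof -
    have "trace (S (N k)) = complex_of_real (t k)"
      using psd_trace[OF psdS[of "N k"]] trS[of "N k"] unfolding t_def by simp
    then have "trace (Y k) = 1"
      using tpos[of k] unfolding Y_def scaleR_eq_cscale trace_cscale by simp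
    moreover have "psd (Y k)"
      unfolding Y_def using tpos[of k] by (intro psd_scaleR psdS) simp
    ultimately show ?thesis by (simp add: density_matrix_def)
  qed
  have "\<exists>l\<in>{A. density_matrix A}. \<exists>r. strict_mono r \<and> (Y \<circ> r) \<longlonglongrightarrow> l"
    using compact_density dens unfolding compact_def by blast
  then obtain l r where l: "density_matrix l" and r: "strict_mono (r :: nat \<Rightarrow> nat)"
    and lim: "(Y \<circ> r) \<longlonglongrightarrow> l" by blast
  have "(\<lambda>k. L (Y k) - Y k) \<longlonglongrightarrow> 0"
  proof (rule Lim_null_comparison)
    have "norm (L (Y k) - Y k) \<le> C * inverse (real (Suc k))" for k
    proof -
      have "L (Y k) - Y k = (1 / t k) *\<^sub>R (L (S (N k)) - S (N k))"
        by (simp add: Y_def linear_scale[OF lin] scaleR_diff_right)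
      then have "norm (L (Y k) - Y k) = norm (L (S (N k)) - S (N k)) * inverse (t k)"
        using tpos[of k] by (simp only: norm_scaleR) (simp add: divide_inverse mult.commute)
      also have "\<dots> \<le> C * inverse (real (Suc k))"
        using bnd t[of k] tpos[of k] order_trans[OF norm_ge_zero bnd]
        by (intro mult_mono le_imp_inverse_le) auto
      finally show ?thesis .
    qed
    then show "\<forall>\<^sub>F k in sequentially. norm (L (Y k) - Y k) \<le> C * inverse (real (Suc k))"
      by simp
    show "(\<lambda>k. C * inverse (real (Suc k))) \<longlonglongrightarrow> 0"
      using tendsto_mult_left[OF LIMSEQ_inverse_real_of_nat, of C] by simp
  qed
  then have "(\<lambda>k. L (Y (r k)) - Y (r k)) \<longlonglongrightarrow> 0"
    using LIMSEQ_subseq_LIMSEQ[OF _ r] by (fastforce simp: o_def)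
  moreover have "(\<lambda>k. L (Y (r k)) - Y (r k)) \<longlonglongrightarrow> L l - l"
    using lim unfolding o_def
    by (intro tendsto_diff bounded_linear.tendsto[OF linear_conv_bounded_linear[THEN iffD1, OF lin]])
  ultimately have "L l - l = 0" using LIMSEQ_unique by blast
  with l show thesis by (intro that[of l]) auto
qed

text \<open>A semidefinite matrix lies below a multiple of the identity, so the traces of its
  iterates are dominated by the terms of a convergent series. Differences and the Cartesian
  decomposition extend this to all matrices.\<close>

lemma funpow_tendsto_0:
  fixes L :: "'n::finite cmap"
  assumes lin: "clinear L" and pos: "positive_map L"
    and sum: "summable (\<lambda>r. Re (trace ((L ^^ r) (mat 1))))"
  shows "(\<lambda>r. (L ^^ r) X) \<longlonglongrightarrow> 0"
proof -
  have linr: "linear (L ^^ r)" for r by (intro clinear_imp_linear clinear_funpow lin)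
  have psd: "(\<lambda>r. (L ^^ r) A) \<longlonglongrightarrow> 0" if A: "psd A" for A
  proof -
    obtain c where c: "c \<ge> 0" "psd (c *\<^sub>R mat 1 - A)"
      using hermitian_bounded psd_iff[THEN iffD1, OF A] by metis
    have "norm ((L ^^ r) A) \<le> (real CARD('n))\<^sup>2 * (c * Re (trace ((L ^^ r) (mat 1))))" for r
    proof -
      have "0 \<le> Re (trace ((L ^^ r) (c *\<^sub>R mat 1 - A)))"
        using psd_trace[OF positive_map_funpow[OF pos c(2)]] by blast
      then have "Re (trace ((L ^^ r) A)) \<le> c * Re (trace ((L ^^ r) (mat 1)))"
        unfolding linear_diff[OF linr] linear_scale[OF linr] linear_diff[OF linear_trace]
          linear_scale[OF linear_trace] by simp
      then show ?thesis
        by (intro order_trans[OF psd_norm_le_trace[OF positive_map_funpow[OF pos A]]]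
            mult_left_mono) auto
    qed
    then have "\<forall>\<^sub>F r in sequentially.
        norm ((L ^^ r) A) \<le> (real CARD('n))\<^sup>2 * (c * Re (trace ((L ^^ r) (mat 1))))" by simp
    moreover have "(\<lambda>r. (real CARD('n))\<^sup>2 * (c * Re (trace ((L ^^ r) (mat 1))))) \<longlonglongrightarrow> 0"
      by (intro tendsto_mult_right_zero summable_LIMSEQ_zero[OF sum])
    ultimately show ?thesis by (rule Lim_null_comparison)
  qed
  have herm: "(\<lambda>r. (L ^^ r) H) \<longlonglongrightarrow> 0" if H: "ctranspose H = H" for H
  proof -
    obtain c where c: "c \<ge> 0" "psd (c *\<^sub>R mat 1 + H)"
      using hermitian_bounded[OF H] by blast
    have "(\<lambda>r. (L ^^ r) (c *\<^sub>R mat 1 + H) - (L ^^ r) (c *\<^sub>R mat 1)) \<longlonglongrightarrow> 0 - 0"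
      by (intro tendsto_diff psd c psd_scaleR psd_mat_1)
    then show ?thesis by (simp add: linear_add[OF linr])
  qed
  obtain H K where HK: "ctranspose H = H" "ctranspose K = K" and X: "X = H + cscale \<i> K"
    by (rule hermitian_decomposition)
  have cs: "bounded_linear (cscale \<i>)"
    by (rule linear_conv_bounded_linear[THEN iffD1], rule linearI)
      (simp_all add: cscale_add_right scaleR_eq_cscale cscale_cscale mult.commute)
  have e: "(L ^^ r) X = (L ^^ r) H + cscale \<i> ((L ^^ r) K)" for r
    using clinear_funpow[OF lin, of r] by (simp add: X clinear_iff)
  have "(\<lambda>r. (L ^^ r) H + cscale \<i> ((L ^^ r) K)) \<longlonglongrightarrow> 0 + cscale \<i> 0"
    by (intro tendsto_add herm HK bounded_linear.tendsto[OF cs])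
  then show ?thesis unfolding e by simp
qed

section \<open>Irreducible maps and the fundamental map\<close>

lemma cmat_mult_diff:
  fixes A B C :: "'n::finite cmat"
  shows "A ** (B - C) = A ** B - A ** C" "(A - B) ** C = A ** C - B ** C"
  by (simp_all add: vec_eq_iff matrix_matrix_mult_def algebra_simps sum_subtractf)

lemma cmat_mult_add:
  fixes A B C :: "'n::finite cmat"
  shows "A ** (B + C) = A ** B + A ** C" "(A + B) ** C = A ** C + B ** C"
  by (simp_all add: vec_eq_iff matrix_matrix_mult_def algebra_simps sum.distrib)

lemma sum_cmod_cinner_axis: "(\<Sum>i\<in>UNIV. (cmod (cinner (axis i 1) x))\<^sup>2) = (norm x)\<^sup>2"
  by (simp add: cinner_axis_left norm_vec_def L2_set_def sum_nonneg)

lemma qform_orth_projection: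
  assumes "orth_projection R"
  shows "qform R x = (norm (R *v x))\<^sup>2"
proof -
  have "cinner x (R *v x) = cinner x (R *v (R *v x))"
    using assms by (simp add: matrix_vector_mul_assoc orth_projection_def)
  also have "\<dots> = cinner (R *v x) (R *v x)"
    unfolding cinner_adjoint[of x R] using assms by (simp add: orth_projection_def)
  finally show ?thesis by (simp add: qform_def cinner_self)
qed

lemma psd_orth_projection: "orth_projection R \<Longrightarrow> psd R"
  by (simp add: psd_iff qform_orth_projection) (simp add: orth_projection_def)

text \<open>Write \<open>R *v axis i 1\<close> as \<open>Y *v w i\<close>. Then the coordinates of
  \<open>R *v x\<close> are values of the form of \<open>Y\<close>, and Cauchy-Schwarz bounds their
  squares by \<open>qform Y (w i) * qform Y x\<close>. The sum \<open>c\<close> plays the part of an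
  inverse spectral gap of \<open>Y\<close>.\<close>

lemma psd_dominates_projection:
  assumes Y: "psd Y" and R: "orth_projection R" and sub: "range ((*v) R) \<subseteq> range ((*v) Y)"
  obtains c where "c \<ge> 0" "psd (c *\<^sub>R Y - R)"
proof -
  have "\<exists>w. R *v axis i 1 = Y *v w" for i using sub by blast
  then obtain w where w: "R *v axis i 1 = Y *v w i" for i by metis
  define c where "c = (\<Sum>i\<in>UNIV. qform Y (w i))"
  have q: "0 \<le> qform Y x" for x using psd_iff[THEN iffD1, OF Y] by blast
  have herm: "ctranspose Y = Y" "ctranspose R = R"
    using psd_iff[THEN iffD1, OF Y] R by (auto simp: orth_projection_def)
  have "qform R x \<le> c * qform Y x" for x
  proof -
    have e: "cinner (axis i 1) (R *v x) = cinner (w i) (Y *v x)" for i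
      unfolding cinner_adjoint[of "axis i 1" R] cinner_adjoint[of "w i" Y] herm w ..
    have "qform R x = (\<Sum>i\<in>UNIV. (cmod (cinner (w i) (Y *v x)))\<^sup>2)"
      unfolding qform_orth_projection[OF R] sum_cmod_cinner_axis[symmetric] e ..
    also have "\<dots> \<le> (\<Sum>i\<in>UNIV. qform Y (w i) * qform Y x)"
      by (intro sum_mono psd_cauchy_schwarz Y)
    finally show ?thesis by (simp add: c_def sum_distrib_right)
  qed
  then have "psd (c *\<^sub>R Y - R)"
    by (simp add: psd_iff qform_diff qform_scaleR ctranspose_diff ctranspose_scaleR herm)
  moreover have "c \<ge> 0" unfolding c_def by (intro sum_nonneg q)
  ultimately show thesis by (intro that)
qed

text \<open>The range of a positive semidefinite fixed point carries an invariant corner algebra.\<close>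

lemma fixed_psd_surj:
  fixes \<Phi> :: "'n::finite cmap"
  assumes lin: "clinear \<Phi>" and pos: "positive_map \<Phi>" and irr: "irreducible_map \<Phi>"
    and Y: "psd Y" and fix_Y: "\<Phi> Y = Y" and nz: "Y \<noteq> 0"
  shows "range ((*v) Y) = UNIV"
proof -
  have linr: "linear \<Phi>" by (rule clinear_imp_linear[OF lin])
  have "vec.subspace (range ((*v) Y))"
    unfolding vec.subspace_def
  proof safe
    show "0 \<in> range ((*v) Y)" by (metis matrix_vector_mult_0_right rangeI)
    show "Y *v x + Y *v y \<in> range ((*v) Y)" for x y
      by (metis matrix_vector_right_distrib rangeI)
    show "c *s (Y *v x) \<in> range ((*v) Y)" for c x
      by (metis vec.scale rangeI)
  qed
  then obtain R where R: "orth_projection R" and range: "range ((*v) R) = range ((*v) Y)"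
    using orth_projection_exists by blast
  have RR: "R ** R = R" and Rh: "ctranspose R = R" using R by (auto simp: orth_projection_def)
  have RY: "R ** Y = Y"
    unfolding matrix_eq matrix_vector_mul_assoc[symmetric]
    using orth_projection_range[OF R] range by blast
  have Yh: "ctranspose Y = Y" using psd_iff[THEN iffD1, OF Y] by blast
  have YR: "Y ** R = Y" using arg_cong[OF RY, of ctranspose] by (simp only: ctranspose_mult Yh Rh)
  obtain c where c: "c \<ge> 0" "psd (c *\<^sub>R Y - R)"
    using psd_dominates_projection[OF Y R] range by blast
  \<comment> \<open>From \<open>R \<le> c Y\<close> and \<open>\<Phi> Y = Y\<close> the form of
    \<open>\<Phi> R\<close> vanishes at \<open>x\<close>. A Hermitian \<open>A\<close> in the corner
    lies between \<open>- d R\<close> and \<open>d R\<close>, so the form of \<open>\<Phi> A\<close>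
    vanishes there too; applying \<open>psd_kernel\<close> to \<open>\<Phi> (d R + A)\<close> turns
    this into a statement about vectors.\<close>
  have ker: "\<Phi> A *v x = 0" if Yx: "Y *v x = 0" and A: "ctranspose A = A" "A = R ** A ** R" for x A
  proof -
    have q0: "qform Y x = 0" using Yx by (simp add: qform_def)
    have sub: "psd (\<Phi> X)" if "psd X" for X using pos that by (simp add: positive_map_def)
    have nonneg: "0 \<le> qform (\<Phi> X) x" if "psd X" for X
      using psd_iff[THEN iffD1, OF sub[OF that]] by blast
    have "qform (\<Phi> R) x \<le> 0"
      using nonneg[OF c(2)] q0 by (simp add: linear_diff[OF linr] linear_scale[OF linr]
          qform_diff qform_scaleR fix_Y)
    then have R0: "qform (\<Phi> R) x = 0"
      using nonneg[OF psd_orth_projection[OF R]] by linarith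
    obtain d where d: "d \<ge> 0" "psd (d *\<^sub>R mat 1 + A)" "psd (d *\<^sub>R mat 1 - A)"
      using hermitian_bounded[OF A(1)] by blast
    have e: "R ** (d *\<^sub>R mat 1 + A) ** R = d *\<^sub>R R + A" "R ** (d *\<^sub>R mat 1 - A) ** R = d *\<^sub>R R - A"
      by (simp_all add: cmat_mult_add cmat_mult_diff
          scaleR_eq_cscale cscale_mult_left cscale_mult_right RR A(2)[symmetric])
    have p: "psd (d *\<^sub>R R + A)" "psd (d *\<^sub>R R - A)"
      using psd_sandwich[OF d(2), of R] psd_sandwich[OF d(3), of R] unfolding Rh e .
    have "qform (\<Phi> A) x \<ge> 0" "qform (\<Phi> A) x \<le> 0"
      using nonneg[OF p(1)] nonneg[OF p(2)] R0
      by (simp_all add: linear_diff[OF linr] linear_add[OF linr] linear_scale[OF linr]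
          qform_diff qform_add qform_scaleR)
    then have "qform (\<Phi> (d *\<^sub>R R + A)) x = 0"
      using R0 by (simp add: linear_add[OF linr] linear_scale[OF linr] qform_add qform_scaleR)
    then have "\<Phi> (d *\<^sub>R R + A) *v x = 0" by (rule psd_kernel[OF sub[OF p(1)]])
    moreover have "\<Phi> R *v x = 0" by (rule psd_kernel[OF sub[OF psd_orth_projection[OF R]] R0])
    ultimately show ?thesis
      unfolding linear_add[OF linr] linear_scale[OF linr]
      unfolding matrix_add_vector scaleR_eq_cscale cscale_matrix_vector by simp
  qed
  have corner_herm: "\<Phi> A = R ** \<Phi> A ** R" if A: "ctranspose A = A" "A = R ** A ** R" for A
  proof -
    have "\<Phi> A *v x = \<Phi> A *v (R *v x)" for x
    proof -
      \<comment> \<open>The part of \<open>x\<close> outside the range of \<open>R\<close> lies in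
        the kernel of \<open>Y\<close>, so \<open>\<Phi> A\<close> ignores it. Adjoints then give
        the same on the left.\<close>
      have "Y *v (x - R *v x) = 0"
        by (simp add: matrix_vector_mult_diff_distrib matrix_vector_mul_assoc YR)
      from ker[OF this A] show ?thesis by (simp add: matrix_vector_mult_diff_distrib)
    qed
    then have right: "\<Phi> A = \<Phi> A ** R"
      unfolding matrix_eq matrix_vector_mul_assoc[symmetric] by blast
    have h: "ctranspose (\<Phi> A) = \<Phi> A" by (rule positive_map_hermitian[OF linr pos A(1)])
    have "\<Phi> A = R ** \<Phi> A"
      using arg_cong[OF right, of ctranspose] by (simp only: ctranspose_mult h Rh)
    with right show ?thesis by (metis matrix_mul_assoc)
  qed
  \<comment> \<open>Compression by \<open>R\<close> respects the Cartesian decomposition, so the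
    Hermitian case extends by complex linearity.\<close>
  have corner: "\<Phi> (R ** X ** R) = R ** \<Phi> (R ** X ** R) ** R" for X
  proof -
    obtain H K where HK: "ctranspose H = H" "ctranspose K = K" and X: "X = H + cscale \<i> K"
      by (rule hermitian_decomposition)
    have h: "ctranspose (R ** A ** R) = R ** A ** R" "R ** A ** R = R ** (R ** A ** R) ** R"
      if "ctranspose A = A" for A
      using that Rh RR by (simp_all only: ctranspose_mult matrix_mul_assoc)
        (simp_all only: RR matrix_mul_assoc[symmetric])
    have X': "R ** X ** R = R ** H ** R + cscale \<i> (R ** K ** R)"
      by (simp add: X cmat_mult_add cscale_mult_left cscale_mult_right)
    have "\<Phi> (R ** X ** R) = \<Phi> (R ** H ** R) + cscale \<i> (\<Phi> (R ** K ** R))"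
      unfolding X' using lin by (simp add: clinear_iff)
    also have "\<dots> = R ** \<Phi> (R ** H ** R) ** R + cscale \<i> (R ** \<Phi> (R ** K ** R) ** R)"
      using corner_herm[OF h[OF HK(1)]] corner_herm[OF h[OF HK(2)]] by (simp only:)
    also have "\<dots> = R ** (\<Phi> (R ** H ** R) + cscale \<i> (\<Phi> (R ** K ** R))) ** R"
      by (simp add: cmat_mult_add cscale_mult_left cscale_mult_right)
    also have "\<Phi> (R ** H ** R) + cscale \<i> (\<Phi> (R ** K ** R)) = \<Phi> (R ** X ** R)"
      unfolding X' using lin by (simp add: clinear_iff)
    finally show ?thesis .
  qed
  have "\<Phi> ` range (\<lambda>X. R ** X ** R) \<subseteq> range (\<lambda>X. R ** X ** R)"
    using corner by blast
  with irr R have "R = 0 \<or> R = mat 1" unfolding irreducible_map_def by blast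
  moreover have "R \<noteq> 0"
  proof
    assume "R = 0"
    then have "Y = 0" using RY by (simp add: matrix_matrix_mult_def vec_eq_iff)
    with nz show False ..
  qed
  ultimately have "R = mat 1" by blast
  then show ?thesis using range by simp
qed

section \<open>Uniqueness of fixed points, the invariant state and the fundamental map\<close>

lemma psd_surj_perturb:
  assumes Y: "psd Y" "range ((*v) Y) = UNIV" and X: "ctranspose X = X"
  obtains e where "e > 0" "psd (Y + e *\<^sub>R X)"
proof -
  obtain c where c: "c \<ge> 0" "psd (c *\<^sub>R Y - mat 1)"
    using psd_dominates_projection[OF Y(1), of "mat 1"] Y(2) by (auto simp: orth_projection_def)
  obtain d where d: "d \<ge> 0" "psd (d *\<^sub>R mat 1 + X)" using hermitian_bounded[OF X] by blast
  \<comment> \<open>Full range gives \<open>c Y \<ge> 1\<close>, and \<open>X \<ge> - d\<close>.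
    Adding \<open>d\<close> copies of the first inequality absorbs the loss in the second and costs
    \<open>c * d\<close> further copies of \<open>Y\<close>, hence this scale.\<close>
  have e: "1 / (c * d + 1) > 0" using c d by (simp add: add_nonneg_pos)
  have "Y + (1 / (c * d + 1)) *\<^sub>R X =
    (1 / (c * d + 1)) *\<^sub>R (Y + d *\<^sub>R (c *\<^sub>R Y - mat 1) + (d *\<^sub>R mat 1 + X))"
  proof -
    have "Y = ((1 / (c * d + 1)) * (c * d + 1)) *\<^sub>R Y" using e by simp
    then have "Y = (1 / (c * d + 1)) *\<^sub>R (Y + d *\<^sub>R (c *\<^sub>R Y))"
      by (simp only: scaleR_scaleR[symmetric] scaleR_add_left)
        (simp add: scaleR_add_right mult.commute add.commute)
    then show ?thesis by (simp add: scaleR_add_right scaleR_diff_right)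
  qed
  moreover have "psd \<dots>"
    by (rule psd_scaleR[OF psd_add[OF psd_add[OF Y(1) psd_scaleR[OF c(2) d(1)]] d(2)] less_imp_le[OF e]])
  ultimately show thesis using e that by metis
qed

text \<open>
  Push the invariant state along a traceless fixed direction until it meets the boundary of the
  cone; the boundary point would be a fixed point that is not surjective.
\<close>

lemma traceless_hermitian_fixed_eq_0:
  fixes \<Phi> :: "'n::finite cmap"
  assumes lin: "clinear \<Phi>" and pos: "positive_map \<Phi>" and irr: "irreducible_map \<Phi>"
    and P: "density_matrix P" "\<Phi> P = P"
    and X: "ctranspose X = X" "trace X = 0" "\<Phi> X = X"
  shows "X = 0"
proof (rule ccontr)
  assume nz: "X \<noteq> 0"
  have linr: "linear \<Phi>" by (rule clinear_imp_linear[OF lin])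
  have pP: "psd P" and tP: "trace P = 1" using P by (auto simp: density_matrix_def)
  have Ph: "ctranspose P = P" using psd_iff[THEN iffD1, OF pP] by blast
  \<comment> \<open>A nonzero traceless matrix has a direction \<open>z\<close> of negative form;
    moving along \<open>X\<close> must leave the cone there, which bounds \<open>S\<close>.\<close>
  have "\<not> psd X" using psd_trace_0[of X] X(2) nz by auto
  then obtain z where z: "qform X z < 0" using X(1) unfolding psd_iff by (meson not_le)
  define S where "S = {t. t \<ge> 0 \<and> psd (P + t *\<^sub>R X)}"
  have S: "t \<le> qform P x / (- qform X x)" if "t \<in> S" "qform X x < 0" for t x
  proof -
    have "psd (P + t *\<^sub>R X)" using that by (simp add: S_def)
    then have "0 \<le> qform (P + t *\<^sub>R X) x" using psd_iff[THEN iffD1] by blast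
    then have "t * (- qform X x) \<le> qform P x" by (simp add: qform_add qform_scaleR)
    then show ?thesis using that(2) by (simp only: pos_le_divide_eq neg_0_less_iff_less)
  qed
  have S0: "0 \<in> S" using pP by (simp add: S_def)
  have bdd: "bdd_above S" using S[OF _ z] by (rule bdd_aboveI)
  define s where "s = Sup S"
  have s0: "0 \<le> s" unfolding s_def by (rule cSup_upper[OF S0 bdd])
  define D where "D = P + s *\<^sub>R X"
  \<comment> \<open>The supremum itself is admissible: for each \<open>x\<close> of negative form
    every element of \<open>S\<close> obeys the same upper bound, so \<open>s\<close> does
    too.\<close>
  have "0 \<le> qform D x" for x
  proof (cases "qform X x < 0")
    case True
    have "s \<le> qform P x / (- qform X x)"
      unfolding s_def using S0 S[OF _ True] by (intro cSup_least) auto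
    then have "s * (- qform X x) \<le> qform P x"
      using True by (simp only: pos_le_divide_eq neg_0_less_iff_less)
    then show ?thesis by (simp add: D_def qform_add qform_scaleR)
  next
    case False
    have "0 \<le> qform P x" using psd_iff[THEN iffD1, OF pP] by blast
    with False s0 show ?thesis by (simp add: D_def qform_add qform_scaleR)
  qed
  then have D: "psd D" by (simp add: psd_iff) (simp add: D_def Ph X ctranspose_add ctranspose_scaleR)
  have "\<Phi> D = D" by (simp add: D_def linear_add[OF linr] linear_scale[OF linr] P X)
  moreover have "D \<noteq> 0"
  proof
    assume "D = 0"
    moreover have "trace D = 1"
      by (simp add: D_def linear_add[OF linear_trace] linear_scale[OF linear_trace] tP X)
    ultimately show False by (simp add: trace_def)
  qed
  \<comment> \<open>Irreducibility puts \<open>D\<close> in the interior of the cone, so a further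
    step \<open>e\<close> along \<open>X\<close> is possible, against the choice of
    \<open>s\<close>.\<close>
  ultimately have "range ((*v) D) = UNIV" by (rule fixed_psd_surj[OF lin pos irr D])
  then obtain e where e: "e > 0" "psd (D + e *\<^sub>R X)"
    using psd_surj_perturb[OF D _ X(1)] by blast
  then have "s + e \<in> S" using s0 by (simp add: S_def D_def scaleR_add_left add.assoc)
  then have "s + e \<le> s" unfolding s_def by (rule cSup_upper[OF _ bdd])
  with e show False by simp
qed

lemma hermitian_Im_trace: "ctranspose A = A \<Longrightarrow> Im (trace A) = 0"
  using arg_cong[OF trace_ctranspose[of A], of Im] by simp

text \<open>A positive map preserves Hermitian matrices, so the two Cartesian parts of
  \<open>X\<close> are fixed separately; their traces are real, so both vanish.\<close>

lemma traceless_fixed_eq_0: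
  fixes \<Phi> :: "'n::finite cmap"
  assumes lin: "clinear \<Phi>" and pos: "positive_map \<Phi>" and irr: "irreducible_map \<Phi>"
    and P: "density_matrix P" "\<Phi> P = P"
    and X: "trace X = 0" "\<Phi> X = X"
  shows "X = 0"
proof -
  have linr: "linear \<Phi>" by (rule clinear_imp_linear[OF lin])
  have uniq: "A = C \<and> B = D"
    if "A + cscale \<i> B = C + cscale \<i> D" "ctranspose A = A" "ctranspose B = B"
      "ctranspose C = C" "ctranspose D = D" for A B C D :: "'n cmat"
  proof -
    have h: "ctranspose (A + cscale \<i> B) = A - cscale \<i> B"
      if "ctranspose A = A" "ctranspose B = B" for A B :: "'n cmat"
      unfolding ctranspose_add ctranspose_cscale that by (simp add: vec_eq_iff)
    have "A - cscale \<i> B = C - cscale \<i> D"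
      using arg_cong[OF that(1), of ctranspose] unfolding h[OF that(2,3)] h[OF that(4,5)] .
    with that(1) show ?thesis by (simp add: vec_eq_iff complex_eq_iff) (smt (verit))
  qed
  obtain H K where HK: "ctranspose H = H" "ctranspose K = K" and X': "X = H + cscale \<i> K"
    by (rule hermitian_decomposition)
  have "\<Phi> H + cscale \<i> (\<Phi> K) = H + cscale \<i> K"
    using X(2) lin unfolding X' by (simp add: clinear_iff)
  then have f: "\<Phi> H = H" "\<Phi> K = K"
    using uniq positive_map_hermitian[OF linr pos] HK by blast+
  have "trace H + \<i> * trace K = 0"
    using X(1) by (simp add: X' trace_add trace_cscale)
  then have t: "trace H = 0" "trace K = 0"
    using hermitian_Im_trace[OF HK(1)] hermitian_Im_trace[OF HK(2)] by (simp_all add: complex_eq_iff)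
  have "H = 0" "K = 0"
    by (rule traceless_hermitian_fixed_eq_0[OF lin pos irr P] HK f t)+
  then show ?thesis by (simp add: X')
qed

text \<open>Trace preservation keeps the traces of the powers at the dimension, so they are not
  summable and a fixed state exists. Two fixed states differ by a traceless fixed point, which is
  zero.\<close>

lemma invariant_state:
  fixes \<Phi> :: "'n::finite cmap"
  assumes lin: "clinear \<Phi>" and pos: "positive_map \<Phi>" and irr: "irreducible_map \<Phi>"
    and tp: "trace_preserving \<Phi>"
  shows "density_matrix (invariant_state \<Phi>)" "\<Phi> (invariant_state \<Phi>) = invariant_state \<Phi>"
proof -
  have "trace ((\<Phi> ^^ r) (mat 1)) = of_nat CARD('n)" for r
    using tp by (induction r) (simp_all add: trace_preserving_def trace_I)
  then have "\<not> summable (\<lambda>r. Re (trace ((\<Phi> ^^ r) (mat 1))))"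
    by (simp add: summable_const_iff)
  moreover have "Re (trace (\<Phi> X)) \<le> Re (trace X)" for X
    using tp by (simp add: trace_preserving_def)
  ultimately obtain Y where Y: "density_matrix Y" "\<Phi> Y = Y"
    using fixed_density_of_not_summable[OF clinear_imp_linear[OF lin] pos] by blast
  have "\<exists>!P. density_matrix P \<and> \<Phi> P = P"
  proof (rule ex1I[of _ Y])
    fix P assume P: "density_matrix P \<and> \<Phi> P = P"
    have "P - Y = 0"
      using P Y by (intro traceless_fixed_eq_0[OF lin pos irr Y])
        (simp_all add: trace_sub density_matrix_def clinear_diff[OF lin])
    then show "P = Y" by simp
  qed (use Y in blast)
  then have "density_matrix (invariant_state \<Phi>) \<and> \<Phi> (invariant_state \<Phi>) = invariant_state \<Phi>"
    unfolding invariant_state_def by (rule theI')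
  then show "density_matrix (invariant_state \<Phi>)" "\<Phi> (invariant_state \<Phi>) = invariant_state \<Phi>"
    by auto
qed

text \<open>The map \<open>T\<close> being inverted preserves the trace, so its kernel consists of
  traceless fixed points and is zero; finite dimension gives surjectivity. On traceless matrices
  \<open>\<Omega>\<close> drops out and \<open>Z\<close> solves the Poisson equation of
  \<open>\<Phi>\<close>.\<close>

lemma fundamental_map_traceless:
  fixes \<Phi> :: "'n::finite cmap"
  assumes lin: "clinear \<Phi>" and pos: "positive_map \<Phi>" and irr: "irreducible_map \<Phi>"
    and tp: "trace_preserving \<Phi>"
  shows "clinear (fundamental_map \<Phi>)"
    and "trace X = 0 \<Longrightarrow> trace (fundamental_map \<Phi> X) = 0"
    and "trace X = 0 \<Longrightarrow> fundamental_map \<Phi> X - \<Phi> (fundamental_map \<Phi> X) = X"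
proof -
  define P where "P = invariant_state \<Phi>"
  have P: "density_matrix P" "\<Phi> P = P"
    unfolding P_def by (rule invariant_state[OF assms])+
  have tP: "trace P = 1" using P by (simp add: density_matrix_def)
  define T where "T X = X - \<Phi> X + Omega_map \<Phi> X" for X
  have T: "T X = X - \<Phi> X + cscale (trace X) P" for X
    by (simp add: T_def Omega_map_def P_def)
  have trT: "trace (T X) = trace X" for X
    using tp by (simp add: T trace_add trace_sub trace_cscale tP trace_preserving_def)
  have linT: "clinear T"
    unfolding clinear_iff
  proof (intro conjI allI)
    show "T (X + Y) = T X + T Y" for X Y
      using lin by (simp add: T clinear_iff trace_add vec_eq_iff algebra_simps)
    show "T (cscale c X) = cscale c (T X)" for c X
      using lin by (simp add: T clinear_iff trace_cscale vec_eq_iff algebra_simps)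
  qed
  have ker: "X = 0" if "T X = 0" for X
  proof -
    have t: "trace X = 0" using trT[of X] that by (simp add: trace_def)
    then have "\<Phi> X = X" using that by (simp add: T)
    with t show ?thesis by (rule traceless_fixed_eq_0[OF lin pos irr P])
  qed
  have "inj T"
    using ker by (simp add: linear_injective_0[OF clinear_imp_linear[OF linT]])
  then have "surj T"
    by (rule linear_inj_imp_surj[OF clinear_imp_linear[OF linT]])
  have Z: "fundamental_map \<Phi> = inv T" by (simp add: fundamental_map_def T_def[abs_def])
  have TZ: "T (fundamental_map \<Phi> X) = X" for X
    unfolding Z by (rule surj_f_inv_f[OF \<open>surj T\<close>])
  have ZT: "fundamental_map \<Phi> (T X) = X" for X
    unfolding Z by (rule inv_f_f[OF \<open>inj T\<close>])
  show "clinear (fundamental_map \<Phi>)"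
    using linT unfolding clinear_iff by (metis TZ ZT)
  show tr: "trace (fundamental_map \<Phi> X) = 0" if "trace X = 0" for X
    using trT[of "fundamental_map \<Phi> X"] that by (simp add: TZ)
  show "fundamental_map \<Phi> X - \<Phi> (fundamental_map \<Phi> X) = X" if "trace X = 0"
    using TZ[of X] tr[OF that] by (simp add: T)
qed

section \<open>Hitting times\<close>

text \<open>The block of terms from \<open>n div 2\<close> to \<open>n\<close> tends to zero by
  convergence, and each of its terms is at least \<open>a n\<close>. Its length
  \<open>n - n div 2\<close> rounds up, so doubling it reaches \<open>n\<close>.\<close>

lemma decseq_summable_mult_tendsto_0:
  fixes a :: "nat \<Rightarrow> real"
  assumes dec: "decseq a" and nonneg: "\<And>n. 0 \<le> a n" and "summable a"
  shows "(\<lambda>n. real n * a n) \<longlonglongrightarrow> 0"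
proof -
  define b where "b n = 2 * ((\<Sum>r<n. a r) - (\<Sum>r<n div 2. a r))" for n
  have lim: "(\<lambda>n. \<Sum>r<n. a r) \<longlonglongrightarrow> suminf a"
    using assms(3) by (rule summable_LIMSEQ)
  have "filterlim (\<lambda>n::nat. n div 2) at_top sequentially"
    by (rule filterlim_at_top_div_const_nat) simp
  then have "(\<lambda>n. \<Sum>r<n div 2. a r) \<longlonglongrightarrow> suminf a"
    by (rule filterlim_compose[OF lim])
  from tendsto_mult_left[OF tendsto_diff[OF lim this], of 2] have b0: "b \<longlonglongrightarrow> 0"
    by (simp add: b_def[abs_def])
  have "real n * a n \<le> b n" for n
  proof -
    have "(\<Sum>r<n. a r) = (\<Sum>r<n div 2. a r) + (\<Sum>r=n div 2..<n. a r)"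
      unfolding lessThan_atLeast0 by (simp add: sum.atLeastLessThan_concat)
    moreover have "(\<Sum>r=n div 2..<n. a n) \<le> (\<Sum>r=n div 2..<n. a r)"
      by (intro sum_mono decseqD[OF dec]) simp
    ultimately have "2 * (real (n - n div 2) * a n) \<le> b n" by (simp add: b_def)
    moreover have "real n * a n \<le> (2 * real (n - n div 2)) * a n"
      by (intro mult_right_mono nonneg) linarith
    ultimately show ?thesis
      using mult.assoc[of 2 "real (n - n div 2)" "a n"] by linarith
  qed
  then show ?thesis
    using nonneg by (intro tendsto_sandwich[OF _ _ tendsto_const b0]) auto
qed

section \<open>The compression of the evolution to the complement of \<open>V\<close>\<close>

locale hitting =
  fixes \<Phi> :: "'n::finite cmap" and V :: "(complex^'n) set"
  assumes lin: "clinear \<Phi>" and pos: "positive_map \<Phi>" and tp: "trace_preserving \<Phi>"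
    and irr: "irreducible_map \<Phi>"
    and V: "vec.subspace V" "V \<noteq> {0}"
begin

definition P where "P = proj_onto V"
definition Q where "Q = mat 1 - proj_onto V"
definition F where "F X = QQ V (\<Phi> X)"
text \<open>Defined by the same inverse as in \<open>mean_hitting_map\<close>, so that
  \<open>K\<close> unfolds to \<open>\<Phi>\<close> after two applications of
  \<open>G\<close>.\<close>

definition G where "G = inv (\<lambda>X. X - F X)"

lemma P_props: "P ** P = P" "ctranspose P = P" "range ((*v) P) = V"
  using proj_onto[OF V(1)] by (auto simp: P_def orth_projection_def)

lemma Q_eq: "Q = mat 1 - P"
  by (simp add: Q_def P_def)

lemma Q_props: "Q ** Q = Q" "ctranspose Q = Q"
  unfolding Q_eq by (simp_all add: cmat_mult_diff P_props ctranspose_diff)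

lemma QQ_eq: "QQ V X = Q ** X ** Q"
  by (simp add: QQ_def Q_def)

lemma PP_eq: "PP V X = P ** X ** P"
  by (simp add: PP_def P_def)

lemma clinear_QQ: "clinear (QQ V)"
  by (simp add: clinear_iff QQ_eq cmat_mult_add cscale_mult_left cscale_mult_right)

lemma QQ_idem: "QQ V (QQ V X) = QQ V X"
proof -
  have "QQ V (QQ V X) = (Q ** Q) ** X ** (Q ** Q)" by (simp only: QQ_eq matrix_mul_assoc)
  then show ?thesis by (simp only: Q_props QQ_eq)
qed

lemma psd_QQ: "psd X \<Longrightarrow> psd (QQ V X)"
  using psd_sandwich[of X Q] by (simp only: QQ_eq Q_props)

lemma psd_PP: "psd X \<Longrightarrow> psd (PP V X)"
  using psd_sandwich[of X P] by (simp only: PP_eq P_props)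

text \<open>Cyclicity and idempotence reduce the compressions to \<open>P ** X\<close> and
  \<open>Q ** X\<close>, and \<open>P + Q\<close> is the identity.\<close>

lemma trace_PP: "trace (PP V X) = trace X - trace (QQ V X)"
proof -
  have "trace (PP V X) = trace (P ** P ** X)"
    unfolding PP_eq by (metis trace_mul_sym matrix_mul_assoc)
  moreover have "trace (QQ V X) = trace (Q ** Q ** X)"
    unfolding QQ_eq by (metis trace_mul_sym matrix_mul_assoc)
  ultimately show ?thesis
    by (simp add: P_props Q_props) (simp add: Q_eq cmat_mult_diff trace_sub)
qed

lemma QQ_pure_state: "v \<in> V \<Longrightarrow> QQ V (pure_state v) = 0"
proof -
  assume "v \<in> V"
  then have "P *v v = v"
    using orth_projection_range[OF proj_onto(1)[OF V(1)]] proj_onto(2)[OF V(1)]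
    by (simp add: P_def)
  then have "Q *v v = 0" by (simp add: Q_eq matrix_diff_vector)
  then have "Q ** pure_state v = 0" by (rule pure_state_mult)
  then show ?thesis unfolding QQ_eq by (simp add: matrix_matrix_mult_def vec_eq_iff)
qed

lemma clinear_F: "clinear F"
  using clinear_compose[OF clinear_QQ lin] by (simp add: F_def[abs_def])

lemma linear_F: "linear F"
  by (rule clinear_imp_linear[OF clinear_F])

lemma pos_F: "positive_map F"
  using pos by (simp add: positive_map_def F_def psd_QQ)

lemma trace_F: "trace (F X) = trace X - trace (PP V (\<Phi> X))"
  using tp by (simp add: trace_PP F_def trace_preserving_def)

lemma trace_PP_nonneg: "psd X \<Longrightarrow> 0 \<le> Re (trace (PP V (\<Phi> X)))"
  using psd_trace[OF psd_PP] pos unfolding positive_map_def by blast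

text \<open>For a state fixed by \<open>F\<close> no mass arrives in \<open>V\<close>, so
  \<open>\<Phi> Y\<close> has zero compression to \<open>V\<close>. Being semidefinite it is
  annihilated by \<open>P\<close> on both sides, hence \<open>\<Phi> Y = F Y = Y\<close>.
  Irreducibility gives \<open>Y\<close> full range, which forces \<open>P = 0\<close>.\<close>

lemma no_fixed_density: "density_matrix Y \<Longrightarrow> F Y \<noteq> Y"
proof
  assume Y: "density_matrix Y" and FY: "F Y = Y"
  have pY: "psd Y" and tY: "trace Y = 1" using Y by (auto simp: density_matrix_def)
  have pA: "psd (\<Phi> Y)" using pos pY by (simp add: positive_map_def)
  then have h: "ctranspose (\<Phi> Y) = \<Phi> Y" using psd_iff[THEN iffD1] by blast
  have PP0: "PP V (\<Phi> Y) = 0"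
    using trace_F[of Y] by (intro psd_trace_0[OF psd_PP[OF pA]]) (simp add: FY)
  have "\<Phi> Y *v (P *v x) = 0" for x
  proof (rule psd_kernel[OF pA])
    have "cinner (P *v x) (\<Phi> Y *v (P *v x)) = cinner x (P *v (\<Phi> Y *v (P *v x)))"
      unfolding cinner_adjoint[of x P] P_props ..
    also have "P *v (\<Phi> Y *v (P *v x)) = PP V (\<Phi> Y) *v x"
      by (simp only: PP_eq matrix_vector_mul_assoc matrix_mul_assoc)
    finally show "qform (\<Phi> Y) (P *v x) = 0" unfolding PP0 by (simp add: qform_def)
  qed
  then have right: "\<Phi> Y ** P = 0"
    unfolding matrix_eq matrix_vector_mul_assoc[symmetric] by simp
  then have left: "P ** \<Phi> Y = 0"
    using arg_cong[OF right, of ctranspose] unfolding ctranspose_mult h P_props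
    by (simp add: vec_eq_iff)
  have "F Y = \<Phi> Y"
    unfolding F_def QQ_eq Q_eq cmat_mult_diff left by (simp add: cmat_mult_diff right)
  then have fix_Y: "\<Phi> Y = Y" using FY by simp
  have "Y \<noteq> 0" using tY by (auto simp: trace_def)
  then have surj: "range ((*v) Y) = UNIV" by (rule fixed_psd_surj[OF lin pos irr pY fix_Y])
  have "P = 0"
  proof -
    have "P *v x = 0" for x
    proof -
      obtain w where "x = Y *v w" using surj by blast
      then have "P *v x = (P ** \<Phi> Y) *v w" by (simp add: fix_Y matrix_vector_mul_assoc)
      then show ?thesis by (simp add: left)
    qed
    then show ?thesis unfolding matrix_eq by simp
  qed
  then have "V = {0}" using P_props(3) by auto
  with V(2) show False ..
qed

lemma F_funpow_tendsto_0: "(\<lambda>r. (F ^^ r) X) \<longlonglongrightarrow> 0"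
proof (rule funpow_tendsto_0[OF clinear_F pos_F], rule ccontr)
  assume ns: "\<not> summable (\<lambda>r. Re (trace ((F ^^ r) (mat 1))))"
  have "Re (trace (F X)) \<le> Re (trace X)" if "psd X" for X
    using trace_PP_nonneg[OF that] by (simp add: trace_F)
  then obtain Y where "density_matrix Y" "F Y = Y"
    using fixed_density_of_not_summable[OF linear_F pos_F _ ns] by blast
  with no_fixed_density show False by blast
qed

section \<open>The resolvent of the compression and its Neumann series\<close>

lemma clinear_resolvent: "clinear (\<lambda>X. X - F X)"
proof -
  have "clinear F" by (rule clinear_F)
  then show ?thesis by (simp add: clinear_iff cscale_diff_right)
qed

text \<open>A kernel element is fixed by all powers of \<open>F\<close>, which tend to zero.\<close>

lemma inj_resolvent: "inj (\<lambda>X. X - F X)"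
  unfolding linear_injective_0[OF clinear_imp_linear[OF clinear_resolvent]]
proof safe
  fix X assume "X - F X = 0"
  then have "F X = X" by simp
  then have "(F ^^ r) X = X" for r by (induction r) simp_all
  then have "(\<lambda>r::nat. X) \<longlonglongrightarrow> 0" using F_funpow_tendsto_0[of X] by simp
  then show "X = 0" by (simp only: LIMSEQ_const_iff)
qed

lemma G_right: "G X - F (G X) = X"
proof -
  have "surj (\<lambda>X. X - F X)"
    by (rule linear_inj_imp_surj[OF clinear_imp_linear[OF clinear_resolvent] inj_resolvent])
  then show ?thesis unfolding G_def by (rule surj_f_inv_f)
qed

lemma G_left: "G (X - F X) = X"
  unfolding G_def by (rule inv_f_f[OF inj_resolvent])

lemma clinear_G: "clinear G"
  using clinear_resolvent unfolding clinear_iff by (metis G_left G_right)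

text \<open>Substituting \<open>X = G X - F (G X)\<close> telescopes the partial sums; the remainder
  is a power of \<open>F\<close> at \<open>G X\<close>.\<close>

lemma trace_G_sums: "(\<lambda>r. trace ((F ^^ r) X)) sums trace (G X)"
proof -
  have "(\<Sum>r<N. trace ((F ^^ r) X)) = trace (G X) - trace ((F ^^ N) (G X))" for N
  proof (induction N)
    case (Suc N)
    have "(F ^^ N) X = (F ^^ N) (G X) - (F ^^ N) (F (G X))"
      using clinear_diff[OF clinear_funpow[OF clinear_F], of N "G X" "F (G X)"]
      by (simp only: G_right)
    also have "(F ^^ N) (F (G X)) = (F ^^ Suc N) (G X)" by (simp only: funpow_swap1 funpow.simps o_apply)
    finally show ?case using Suc by (simp add: trace_sub)
  qed simp
  moreover have "(\<lambda>N. trace ((F ^^ N) (G X))) \<longlonglongrightarrow> trace (0 :: 'n cmat)"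
    by (rule bounded_linear.tendsto[OF linear_conv_bounded_linear[THEN iffD1, OF linear_trace]
        F_funpow_tendsto_0])
  then have "(\<lambda>N. trace (G X) - trace ((F ^^ N) (G X))) \<longlonglongrightarrow> trace (G X) - 0"
    by (intro tendsto_diff tendsto_const) (simp add: trace_def)
  ultimately show ?thesis by (simp add: sums_def)
qed

section \<open>The mean hitting time as a trace\<close>

lemma mean_hitting_time_eq:
  assumes "density_matrix \<rho>"
  shows "mean_hitting_time \<Phi> V \<rho> = ereal (Re (trace (G \<rho>)))" "Im (trace (G \<rho>)) = 0"
proof -
  have p: "psd \<rho>" and t: "trace \<rho> = 1" using assms by (auto simp: density_matrix_def)
  define a where "a r = Re (trace ((F ^^ r) \<rho>))" for r
  have pF: "psd ((F ^^ r) \<rho>)" for r by (rule positive_map_funpow[OF pos_F p])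
  have tr: "trace ((F ^^ r) \<rho>) = complex_of_real (a r)" and a_nonneg: "0 \<le> a r" for r
    using psd_trace[OF pF] unfolding a_def by blast+
  have a_sums: "a sums Re (trace (G \<rho>))"
    using sums_Re[OF trace_G_sums[of \<rho>]] unfolding tr by simp
  have "(\<lambda>r. 0) sums Im (trace (G \<rho>))"
    using sums_Im[OF trace_G_sums[of \<rho>]] unfolding tr by simp
  then show "Im (trace (G \<rho>)) = 0" using sums_unique2 sums_zero by blast
  \<comment> \<open>Here \<open>a r\<close> is the probability of not having been found in
    \<open>V\<close> during the first \<open>r\<close> steps. Arrival at step \<open>Suc r\<close>
    involves exactly \<open>r\<close> powers of \<open>F\<close>.\<close>
  have hit: "hit_prob_at \<Phi> V \<rho> (Suc r) = a r - a (Suc r)" for r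
  proof -
    have "QQ V \<circ> \<Phi> = F" by (simp add: fun_eq_iff F_def)
    then have "hit_prob_at \<Phi> V \<rho> (Suc r) = Re (trace (PP V (\<Phi> ((F ^^ r) \<rho>))))"
      by (simp add: hit_prob_at_def)
    then show ?thesis by (simp add: a_def trace_F)
  qed
  have step: "a (Suc r) \<le> a r" for r
    using trace_PP_nonneg[OF pF[of r]] by (simp add: a_def trace_F)
  then have dec: "decseq a" by (rule decseq_SucI)
  have a0: "a 0 = 1" by (simp add: a_def t)
  have summ: "summable a" using a_sums by (rule sums_summable)
  \<comment> \<open>Total mass one arrives in \<open>V\<close>, so the finite branch of the
    definition applies.\<close>
  have "(\<lambda>r. a r - a (Suc r)) sums (a 0 - 0)"
    by (rule telescope_sums'[OF summable_LIMSEQ_zero[OF summ]])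
  then have "hit_prob \<Phi> V \<rho> = 1"
    unfolding hit_prob_def hit a0
    by (metis diff_zero one_ereal_def sums_ereal sums_unique)
  moreover have "(\<lambda>r. real (Suc r) * (a r - a (Suc r))) sums Re (trace (G \<rho>))"
  proof -
    \<comment> \<open>Summation by parts; the boundary term vanishes because \<open>a\<close> is
      decreasing and summable.\<close>
    have "(\<Sum>r<N. real (Suc r) * (a r - a (Suc r))) = (\<Sum>r<N. a r) - real N * a N" for N
      by (induction N) (simp_all add: algebra_simps)
    moreover have "(\<lambda>N. (\<Sum>r<N. a r) - real N * a N) \<longlonglongrightarrow> Re (trace (G \<rho>)) - 0"
      using a_sums unfolding sums_def
      by (intro tendsto_diff decseq_summable_mult_tendsto_0 dec a_nonneg summ)
    ultimately show ?thesis by (simp add: sums_def)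
  qed
  then have "(\<Sum>r. ereal (real (Suc r) * (a r - a (Suc r)))) = ereal (Re (trace (G \<rho>)))"
    by (metis sums_ereal sums_unique)
  ultimately show "mean_hitting_time \<Phi> V \<rho> = ereal (Re (trace (G \<rho>)))"
    by (simp only: mean_hitting_time_def hit refl if_True)
qed

section \<open>Block maps and the hitting time formula\<close>

lemma QQ_compl_idem: "QQ_compl V (QQ_compl V X) = QQ_compl V X"
  by (simp add: QQ_compl_def clinear_diff[OF clinear_QQ] QQ_idem)

lemma clinear_QQ_compl: "clinear (QQ_compl V)"
proof -
  have "clinear (QQ V)" by (rule clinear_QQ)
  then show ?thesis by (simp add: clinear_iff QQ_compl_def cscale_diff_right)
qed

text \<open>Under the trace the outer \<open>QQ_compl V\<close> composed with \<open>\<Phi>\<close>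
  acts as the identity minus \<open>F\<close>, which cancels one of the two resolvents in
  \<open>K\<close>.\<close>

lemma trace_K11: "trace (block11 V (mean_hitting_map \<Phi> V) Y) = trace (G (QQ_compl V Y))"
proof -
  have "trace (QQ_compl V (\<Phi> X)) = trace (X - F X)" for X
    using tp by (simp add: QQ_compl_def trace_sub F_def trace_preserving_def)
  moreover have "block11 V (mean_hitting_map \<Phi> V) Y = QQ_compl V (\<Phi> (G (G (QQ_compl V Y))))"
    by (simp add: block11_def mean_hitting_map_def numeral_2_eq_2 G_def F_def[abs_def])
  ultimately show ?thesis by (simp only: G_right)
qed

text \<open>Compressing the Poisson equation \<open>X - \<Phi> X = \<eta>\<close> gives
  \<open>QQ V X = F X + QQ V \<eta>\<close>. Hence
  \<open>QQ_compl V X = (X - F X) - QQ V \<eta>\<close>, and \<open>G\<close> recovers the traceless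
  \<open>X\<close> from the bracket.\<close>

lemma trace_G_fundamental:
  assumes "trace \<eta> = 0"
  shows "trace (G (QQ_compl V (fundamental_map \<Phi> \<eta>))) = - trace (G (QQ V \<eta>))"
proof -
  define X where "X = fundamental_map \<Phi> \<eta>"
  note fm = fundamental_map_traceless[OF lin pos irr tp]
  have X: "trace X = 0" "X - \<Phi> X = \<eta>" unfolding X_def using fm assms by blast+
  have "QQ_compl V X = (X - F X) - QQ V \<eta>"
    unfolding X(2)[symmetric] clinear_diff[OF clinear_QQ] QQ_compl_def F_def by simp
  then have "G (QQ_compl V X) = X - G (QQ V \<eta>)"
    by (simp only: clinear_diff[OF clinear_G, of "X - F X" "QQ V \<eta>"] G_left)
  then show ?thesis by (simp add: X(1) trace_sub flip: X_def)
qed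

lemma trace_G_hitting:
  fixes \<psi> :: "complex^'n"
  assumes \<psi>: "\<psi> \<in> V" "norm \<psi> = 1" and \<rho>: "trace \<rho> = 1"
  defines "K \<equiv> mean_hitting_map \<Phi> V" and "Z \<equiv> fundamental_map \<Phi>" and "\<sigma> \<equiv> QQ V (\<Phi> \<rho>)"
  shows "trace (G \<rho>) = 1 + trace (block11 V K (block11 V Z (pure_state \<psi>))) * trace \<sigma>
    - trace (block11 V K (block12 V Z \<sigma>))"
proof -
  have clinZ: "clinear Z" unfolding Z_def by (rule fundamental_map_traceless[OF lin pos irr tp])
  \<comment> \<open>The multiple of the state of \<open>\<psi>\<close> cancels the trace of
    \<open>\<sigma>\<close> and is invisible to \<open>QQ V\<close>, since \<open>\<psi>\<close>
    lies in \<open>V\<close>.\<close>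
  define \<eta> where "\<eta> = cscale (trace \<sigma>) (pure_state \<psi>) - \<sigma>"
  have Qs: "QQ V \<sigma> = \<sigma>" unfolding \<sigma>_def by (rule QQ_idem)
  have Qp: "QQ V (pure_state \<psi>) = 0" by (rule QQ_pure_state[OF \<psi>(1)])
  have "trace \<eta> = 0" by (simp add: \<eta>_def trace_sub trace_cscale trace_pure_state \<psi>)
  moreover have "QQ V \<eta> = - \<sigma>"
  proof -
    have "QQ V (cscale (trace \<sigma>) (pure_state \<psi>)) = cscale (trace \<sigma>) (QQ V (pure_state \<psi>))"
      using clinear_QQ by (simp add: clinear_iff)
    then show ?thesis by (simp add: \<eta>_def clinear_diff[OF clinear_QQ] Qp Qs)
  qed
  ultimately have 1: "trace (G (QQ_compl V (Z \<eta>))) = - trace (G (- \<sigma>))"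
    unfolding Z_def using trace_G_fundamental by metis
  have "trace (G (- \<sigma>)) = - trace (G \<sigma>)"
    using clinear_diff[OF clinear_G, of 0 \<sigma>] linear_0[OF clinear_imp_linear[OF clinear_G]]
      trace_sub[of 0 "G \<sigma>"] by (simp add: trace_def)
  then have 2: "trace (G \<sigma>) = trace (G (QQ_compl V (Z \<eta>)))" using 1 by simp
  \<comment> \<open>First-step decomposition: \<open>\<sigma>\<close> is
    \<open>F \<rho>\<close>.\<close>
  have "G \<rho> = \<rho> + G \<sigma>"
  proof -
    have "G \<rho> - G \<sigma> = G (\<rho> - F \<rho>)" unfolding clinear_diff[OF clinear_G] by (simp add: F_def \<sigma>_def)
    then show ?thesis by (simp add: G_left algebra_simps)
  qed
  then have "trace (G \<rho>) = 1 + trace (G \<sigma>)" by (simp add: trace_add \<rho>)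
  moreover have "trace (G (QQ_compl V (Z \<eta>))) =
      trace \<sigma> * trace (G (QQ_compl V (Z (pure_state \<psi>)))) - trace (G (QQ_compl V (Z \<sigma>)))"
  proof -
    have c: "clinear (\<lambda>X. G (QQ_compl V (Z X)))"
      by (intro clinear_compose[OF clinear_G] clinear_compose[OF clinear_QQ_compl] clinZ)
    have "G (QQ_compl V (Z (cscale d X))) = cscale d (G (QQ_compl V (Z X)))" for d X
      using c by (simp add: clinear_iff)
    then show ?thesis
      unfolding \<eta>_def by (simp only: clinear_diff[OF c] trace_sub trace_cscale)
  qed
  moreover have "block11 V Z (pure_state \<psi>) = QQ_compl V (Z (pure_state \<psi>))"
    by (simp add: block11_def QQ_compl_def Qp)
  moreover have "block12 V Z \<sigma> = QQ_compl V (Z \<sigma>)" by (simp add: block12_def Qs)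
  ultimately show ?thesis using 2 by (simp add: K_def trace_K11 QQ_compl_idem mult.commute)
qed

end

text \<open>The witness \<open>t\<close> records that the extended-real hitting time is finite and
  lets it be compared with complex traces. The form without case distinction comes first; the other
  follows by linearity.\<close>

theorem theorem4p7:
  fixes \<Phi> :: "complex^'n::finite^'n \<Rightarrow> complex^'n^'n"
    and V :: "(complex^'n) set"
    and \<psi> \<phi> :: "complex^'n"
  defines "Z \<equiv> fundamental_map \<Phi>"
    and "K \<equiv> mean_hitting_map \<Phi> V"
    and "\<sigma> \<equiv> QQ V (\<Phi> (pure_state \<phi>))"
  assumes "Vector_Spaces.linear cscale cscale \<Phi>"
    and "positive_map \<Phi>"
    and "trace_preserving \<Phi>"
    and "irreducible_map \<Phi>"
    and "vec.subspace V"
    and "V \<noteq> {0}"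
    and "V \<noteq> UNIV"
    and "\<psi> \<in> V"
    and "norm \<psi> = 1"
    and "norm \<phi> = 1"
  shows "\<exists>t::real. mean_hitting_time \<Phi> V (pure_state \<phi>) = ereal t \<and>
           complex_of_real t =
             (if \<sigma> = 0 then 1
              else let \<rho>hat = cscale (1 / trace \<sigma>) \<sigma> in
                1 + trace \<sigma> *
                  trace (block11 V K (block11 V Z (pure_state \<psi>) - block12 V Z \<rho>hat))) \<and>
           complex_of_real t =
             1 + trace (block11 V K (block11 V Z (pure_state \<psi>))) * trace \<sigma>
               - trace (block11 V K (block12 V Z \<sigma>))"
proof -
  interpret hitting \<Phi> V by (rule hitting.intro) fact+
  have dens: "density_matrix (pure_state \<phi>)"
    using \<open>norm \<phi> = 1\<close> by (simp add: density_matrix_def psd_pure_state trace_pure_state)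
  define t where "t = Re (trace (G (pure_state \<phi>)))"
  have t: "mean_hitting_time \<Phi> V (pure_state \<phi>) = ereal t"
    and t': "complex_of_real t = trace (G (pure_state \<phi>))"
    using mean_hitting_time_eq[OF dens] by (simp_all add: t_def complex_eq_iff)
  have tr1: "trace (pure_state \<phi>) = 1" using dens by (simp add: density_matrix_def)
  have formula: "complex_of_real t = 1 + trace (block11 V K (block11 V Z (pure_state \<psi>))) * trace \<sigma>
      - trace (block11 V K (block12 V Z \<sigma>))"
    unfolding t' K_def Z_def \<sigma>_def
    by (rule trace_G_hitting[OF \<open>\<psi> \<in> V\<close> \<open>norm \<psi> = 1\<close> tr1])
  have clinZ: "clinear Z"
    unfolding Z_def by (rule fundamental_map_traceless[OF lin pos irr tp])
  have K11: "trace (block11 V K Y) = trace (G (QQ_compl V Y))" for Y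
    unfolding K_def by (rule trace_K11)
  have clinK: "clinear (\<lambda>Y. G (QQ_compl V Y))"
    by (rule clinear_compose[OF clinear_G clinear_QQ_compl])
  have clin12: "clinear (block12 V Z)"
    using clinear_compose[OF clinear_QQ_compl clinear_compose[OF clinZ clinear_QQ]]
    by (simp add: block12_def o_def)
  have "complex_of_real t = (if \<sigma> = 0 then 1
      else let \<rho>hat = cscale (1 / trace \<sigma>) \<sigma> in
        1 + trace \<sigma> * trace (block11 V K (block11 V Z (pure_state \<psi>) - block12 V Z \<rho>hat)))"
  proof (cases "\<sigma> = 0")
    case True
    \<comment> \<open>For \<open>\<sigma> = 0\<close> one trace term has the factor
      \<open>trace \<sigma>\<close> and the other vanishes by linearity.\<close>
    have "G (QQ_compl V (block12 V Z 0)) = 0"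
      using linear_0[OF clinear_imp_linear[OF clinear_compose[OF clinK clin12]]] by simp
    then have "trace (block11 V K (block12 V Z 0)) = 0" unfolding K11 by (simp add: trace_def)
    with True formula show ?thesis by (simp add: linear_0[OF linear_trace])
  next
    case False
    have "psd (\<Phi> (pure_state \<phi>))"
      using pos psd_pure_state unfolding positive_map_def by blast
    then have "psd \<sigma>" unfolding \<sigma>_def by (rule psd_QQ)
    \<comment> \<open>A nonzero semidefinite matrix has nonzero trace, so the normalisation is a
      genuine division and the outer factor \<open>trace \<sigma>\<close> undoes it.\<close>
    then have nz: "trace \<sigma> \<noteq> 0" using psd_trace_0[of \<sigma>] False by auto
    have "block12 V Z (cscale (1 / trace \<sigma>) \<sigma>) = cscale (1 / trace \<sigma>) (block12 V Z \<sigma>)"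
      using clin12 by (simp add: clinear_iff)
    moreover have "G (QQ_compl V (cscale c Y)) = cscale c (G (QQ_compl V Y))" for c Y
      using clinK by (simp add: clinear_iff)
    ultimately have eq: "trace (block11 V K (block11 V Z (pure_state \<psi>) - block12 V Z (cscale (1 / trace \<sigma>) \<sigma>)))
        = trace (block11 V K (block11 V Z (pure_state \<psi>)))
          - 1 / trace \<sigma> * trace (block11 V K (block12 V Z \<sigma>))"
      unfolding K11 by (simp add: clinear_diff[OF clinK] trace_sub trace_cscale)
    have "trace \<sigma> * (a - 1 / trace \<sigma> * b) = a * trace \<sigma> - b" for a b
      using nz by (simp add: field_simps)
    then show ?thesis
      unfolding Let_def eq using False formula by (simp add: add_diff_eq)
  qed
  with t formula show ?thesis by blast
qed

end
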